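(* Let $X_1,\dots,X_n$ be a piecewise locally stationary process, let $H:\mathbb{R}^2\to\mathbb{R}$ and $W_n:[0,1]^2\to\mathbb{R}$ be symmetric Borel functions, and let $D_n$ and $\delta_X$ be as defined in the context. Assume: (1) For some $\eta\in(0,1]$ and some function $L:\mathbb{R}\to\mathbb{R}$, the function $H^*(t,s):=H(t,s)/[L(t)L(s)]$ belongs to $W_0^{\eta}(\mathbb{R}^2)$. (2) $L$ is differentiable with derivative $L'$; there is a finite constant $C$ such that $\max_{a\le t\le b}|L'(t)|\le C(|L'(a)|+|L'(b)|+1)$ for all $a\le b$; and $\sup_n\max_{1\le j\le n}\|L(X_j)\|_{8}<\infty$, $\sup_n\max_{1\le j\le n}\|L'(X_j)\|_{8}<\infty$. (3) For some $\rho\in[0,1)$, $\delta_X(k,8)=O(\rho^k)$ as $k\to\infty$. (4) There exist functions $f_n$ and a $p\in(0,\infty)$ such that $$|W_n(t_l,t_m)-W_n(t_k,t_j)|\le f_n(t_k,t_j)\,|(l,m)-(k,j)|^p$$ for all integers $k,j,l,m\in\{1,\dots,n\}$. Then $$\|D_n-E D_n\|_2^2=O(W_{(n)}+\Delta_n)\quad\text{as }n\to\infty,$$ where $W_{(n)}=\sum_{k=1}^n\sum_{j=1}^nW_n^2(t_k,t_j)$ and $\Delta_n=\sum_{k=1}^n\sum_{j=1}^n|W_n(t_k,t_j)|f_n(t_k,t_j)$.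
   Context: Notation: $t_k=k/n$; $\|Y\|_p=(E|Y|^p)^{1/p}$; $|\cdot|$ is the Euclidean norm on $\mathbb{R}^2$; $i=\sqrt{-1}$. Piecewise locally stationary model: there are a fixed integer $r\ge0$ and fixed points $0=d_0<d_1<\dots<d_r<d_{r+1}=1$ such that, for each $n$, $$X_k=\sum_{j=0}^rG_j(t_k,\mathcal F_k)\mathbf 1\{d_j<t_k\le d_{j+1}\},\qquad k=1,\dots,n,$$ where $\mathcal F_k=(\dots,\varepsilon_{k-1},\varepsilon_k)$, $(\varepsilon_k)_{k\in\mathbb Z}$ are i.i.d. random variables and $G_j:(d_j,d_{j+1}]\times\mathbb{R}^{\mathbb N}\to\mathbb{R}$ are measurable. Dependence measures: $\delta_X(k,p)=\max_{0\le l\le r}\sup_{t\in(d_l,d_{l+1}]}\|G_l(t,\mathcal F_0)-G_l(t,\mathcal F_{0,-k})\|_p$, where $\mathcal F_{0,-k}$ is $\mathcal F_0$ with $\varepsilon_{-k}$ replaced by $\varepsilon'_{-k}$, and $(\varepsilon'_j)$ is an independent i.i.d. copy of $(\varepsilon_j)$. Wiener ring: for $\eta\ge0$, $f:\mathbb{R}^2\to\mathbb{R}$ belongs to $W_0^\eta(\mathbb{R}^2)$ if there is $g\in L^1(\mathbb{R}^2)$, complex valued, with $f(x,y)=\int_{\mathbb{R}^2}g(t,s)e^{itx+isy}\,dt\,ds$ and $\int_{\mathbb{R}^2}|(t,s)|^{\eta}|g(t,s)|\,dt\,ds<\infty$. Definitions: let $g$ be the function representing $H^*$ in this way, $\beta_k(x)=L(X_k)\exp(ixX_k)$,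 $\gamma_k(x)=\beta_k(x)-E[\beta_k(x)]$, and $$D_n=\int_{\mathbb{R}^2}g(x,y)\sum_{k=1}^n\sum_{j=1}^nW_n(t_k,t_j)\gamma_k(x)\gamma_j(y)\,dx\,dy .$$ ($D_n$ is the degenerate part of $V_n=\sum_{k,j=1}^nW_n(t_k,t_j)H(X_k,X_j)$.) *)

theory Defs
  imports "HOL-Probability.Probability" "HOL-Library.Landau_Symbols"
begin

section \<open>Extended-valued norms and growth rates\<close>

text \<open>The norm takes values in \<^typ>\<open>ennreal\<close>, so that a variable without a finite \<open>p\<close>-th
  moment has norm \<open>\<infinity>\<close>. Only \<open>0 < p < \<infinity>\<close> is meaningful.\<close>

definition Lp_norm :: "'a measure \<Rightarrow> real \<Rightarrow> ('a \<Rightarrow> 'b::real_normed_vector) \<Rightarrow> ennreal" where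
  "Lp_norm M p Y =
     (let I = (\<integral>\<^sup>+ \<omega>. ennreal (norm (Y \<omega>) powr p) \<partial>M)
      in if I = \<infinity> then \<infinity> else ennreal (enn2real I powr (1 / p)))"

text \<open>\<open>f = O(g)\<close> along \<open>sequentially\<close> for extended nonnegative \<open>f\<close> and real \<open>g\<close>; in
  particular \<open>f\<close> is eventually finite.\<close>

definition ennreal_bigo :: "(nat \<Rightarrow> ennreal) \<Rightarrow> (nat \<Rightarrow> real) \<Rightarrow> bool" where
  "ennreal_bigo f g \<longleftrightarrow> (\<exists>C. \<forall>\<^sub>F n in sequentially. f n \<le> ennreal (C * \<bar>g n\<bar>))"

lemma ennreal_bigo_iff:
  "ennreal_bigo f g \<longleftrightarrow>
     (\<forall>\<^sub>F n in sequentially. f n < \<infinity>) \<and> (\<lambda>n. enn2real (f n)) \<in> O(g)"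
proof
  assume "ennreal_bigo f g"
  then obtain C where C: "\<forall>\<^sub>F n in sequentially. f n \<le> ennreal (C * \<bar>g n\<bar>)"
    unfolding ennreal_bigo_def by blast
  have "\<forall>\<^sub>F n in sequentially. f n < \<infinity>"
    using C by eventually_elim (auto intro: le_less_trans)
  moreover have "\<forall>\<^sub>F n in sequentially. norm (enn2real (f n)) \<le> \<bar>C\<bar> * norm (g n)"
    using C
  proof eventually_elim
    case (elim n)
    have "ennreal (C * \<bar>g n\<bar>) \<le> ennreal (\<bar>C\<bar> * \<bar>g n\<bar>)"
      by (intro ennreal_leI mult_right_mono) auto
    with elim have "f n \<le> ennreal (\<bar>C\<bar> * \<bar>g n\<bar>)" by (rule order_trans)
    then show ?case by (simp add: enn2real_leI)
  qed
  ultimately show "(\<forall>\<^sub>F n in sequentially. f n < \<infinity>) \<and> (\<lambda>n. enn2real (f n)) \<in> O(g)"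
    by (auto intro: bigoI)
next
  assume *: "(\<forall>\<^sub>F n in sequentially. f n < \<infinity>) \<and> (\<lambda>n. enn2real (f n)) \<in> O(g)"
  then obtain C where C: "\<forall>\<^sub>F n in sequentially. norm (enn2real (f n)) \<le> C * norm (g n)"
    by (auto elim: landau_o.bigE)
  have "\<forall>\<^sub>F n in sequentially. f n \<le> ennreal (C * \<bar>g n\<bar>)"
    using C conjunct1[OF *]
  proof eventually_elim
    case (elim n)
    then have "f n = ennreal (enn2real (f n))" by simp
    also have "\<dots> \<le> ennreal (C * \<bar>g n\<bar>)" using elim by (intro ennreal_leI) auto
    finally show ?case .
  qed
  then show "ennreal_bigo f g" unfolding ennreal_bigo_def by blast
qed


section \<open>Piecewise locally stationary processes\<close>

definition iid_with_copy ::
    "'a measure \<Rightarrow> (int \<Rightarrow> 'a \<Rightarrow> real) \<Rightarrow> (int \<Rightarrow> 'a \<Rightarrow> real) \<Rightarrow> bool" where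
  "iid_with_copy M eps eps' \<longleftrightarrow>
     prob_space.indep_vars M (\<lambda>_. borel) (case_sum eps eps') (UNIV :: (int + int) set) \<and>
     (\<forall>k. distr M borel (eps k) = distr M borel (eps 0)) \<and>
     (\<forall>k. distr M borel (eps' k) = distr M borel (eps 0))"

text \<open>\<open>\<F>\<^sub>k = (\<dots>, \<epsilon>\<^sub>k\<^sub>-\<^sub>1, \<epsilon>\<^sub>k)\<close>, read backwards from the present.\<close>

definition history :: "(int \<Rightarrow> 'a \<Rightarrow> real) \<Rightarrow> int \<Rightarrow> 'a \<Rightarrow> nat \<Rightarrow> real" where
  "history eps k \<omega> = (\<lambda>i. eps (k - int i) \<omega>)"

text \<open>The break points are \<open>d 0 < \<dots> < d (r + 1)\<close>. Only the values of \<open>G j t\<close> for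
  \<open>d j < t \<le> d (j + 1)\<close> are ever used.\<close>

definition pls_model ::
    "'a measure \<Rightarrow> (int \<Rightarrow> 'a \<Rightarrow> real) \<Rightarrow> (int \<Rightarrow> 'a \<Rightarrow> real) \<Rightarrow> nat \<Rightarrow> (nat \<Rightarrow> real) \<Rightarrow>
      (nat \<Rightarrow> real \<Rightarrow> (nat \<Rightarrow> real) \<Rightarrow> real) \<Rightarrow> bool" where
  "pls_model M eps eps' r d G \<longleftrightarrow>
     prob_space M \<and> iid_with_copy M eps eps' \<and>
     d 0 = 0 \<and> d (Suc r) = 1 \<and> (\<forall>j\<le>r. d j < d (Suc j)) \<and>
     (\<forall>j\<le>r. (\<lambda>(t, x). G j t x) \<in> borel_measurable
        (restrict_space borel {d j<..d (Suc j)} \<Otimes>\<^sub>M (\<Pi>\<^sub>M i\<in>(UNIV :: nat set). borel)))"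

definition pls_process ::
    "(int \<Rightarrow> 'a \<Rightarrow> real) \<Rightarrow> nat \<Rightarrow> (nat \<Rightarrow> real) \<Rightarrow>
      (nat \<Rightarrow> real \<Rightarrow> (nat \<Rightarrow> real) \<Rightarrow> real) \<Rightarrow> nat \<Rightarrow> nat \<Rightarrow> 'a \<Rightarrow> real" where
  "pls_process eps r d G n k \<omega> =
     (\<Sum>j=0..r. G j (real k / real n) (history eps (int k) \<omega>) *
                indicator {d j<..d (Suc j)} (real k / real n))"

definition dep_measure ::
    "'a measure \<Rightarrow> (int \<Rightarrow> 'a \<Rightarrow> real) \<Rightarrow> (int \<Rightarrow> 'a \<Rightarrow> real) \<Rightarrow> nat \<Rightarrow> (nat \<Rightarrow> real) \<Rightarrow>
      (nat \<Rightarrow> real \<Rightarrow> (nat \<Rightarrow> real) \<Rightarrow> real) \<Rightarrow> nat \<Rightarrow> real \<Rightarrow> ennreal" where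
  "dep_measure M eps eps' r d G k p =
     (MAX l\<in>{0..r}. SUP t\<in>{d l<..d (Suc l)}.
        Lp_norm M p (\<lambda>\<omega>. G l t (history eps 0 \<omega>) -
                          G l t (history (eps(- int k := eps' (- int k))) 0 \<omega>)))"


section \<open>Wiener ring\<close>

definition wiener_repr ::
    "real \<Rightarrow> (real \<Rightarrow> real \<Rightarrow> real) \<Rightarrow> (real \<times> real \<Rightarrow> complex) \<Rightarrow> bool" where
  "wiener_repr \<eta> f g \<longleftrightarrow>
     integrable lborel g \<and>
     (\<forall>x y. complex_of_real (f x y) =
        (\<integral>z. g z * exp (\<i> * complex_of_real (fst z * x) + \<i> * complex_of_real (snd z * y)) \<partial>lborel)) \<and>
     integrable lborel (\<lambda>z. norm z powr \<eta> * norm (g z))"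

definition wiener_ring :: "real \<Rightarrow> (real \<Rightarrow> real \<Rightarrow> real) set" where
  "wiener_ring \<eta> = {f. \<exists>g. wiener_repr \<eta> f g}"


section \<open>The degenerate part of a weighted V-statistic\<close>

definition beta :: "(real \<Rightarrow> real) \<Rightarrow> ('a \<Rightarrow> real) \<Rightarrow> real \<Rightarrow> 'a \<Rightarrow> complex" where
  "beta L Y x \<omega> = complex_of_real (L (Y \<omega>)) * exp (\<i> * complex_of_real (x * Y \<omega>))"

definition gamma ::
    "'a measure \<Rightarrow> (real \<Rightarrow> real) \<Rightarrow> ('a \<Rightarrow> real) \<Rightarrow> real \<Rightarrow> 'a \<Rightarrow> complex" where
  "gamma M L Y x \<omega> = beta L Y x \<omega> - (\<integral>\<omega>'. beta L Y x \<omega>' \<partial>M)"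

definition degenerate_part ::
    "'a measure \<Rightarrow> (real \<times> real \<Rightarrow> complex) \<Rightarrow> (real \<Rightarrow> real) \<Rightarrow>
      (nat \<Rightarrow> real \<Rightarrow> real \<Rightarrow> real) \<Rightarrow> (nat \<Rightarrow> nat \<Rightarrow> 'a \<Rightarrow> real) \<Rightarrow> nat \<Rightarrow> 'a \<Rightarrow> complex" where
  "degenerate_part M g L W X n \<omega> =
     (\<integral>z. g z * (\<Sum>k=1..n. \<Sum>j=1..n.
        complex_of_real (W n (real k / real n) (real j / real n)) *
        gamma M L (X n k) (fst z) \<omega> * gamma M L (X n j) (snd z) \<omega>) \<partial>lborel)"

definition weight_sum :: "(nat \<Rightarrow> real \<Rightarrow> real \<Rightarrow> real) \<Rightarrow> nat \<Rightarrow> real" where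
  "weight_sum W n = (\<Sum>k=1..n. \<Sum>j=1..n. (W n (real k / real n) (real j / real n))\<^sup>2)"

definition weight_delta ::
    "(nat \<Rightarrow> real \<Rightarrow> real \<Rightarrow> real) \<Rightarrow> (nat \<Rightarrow> real \<Rightarrow> real \<Rightarrow> real) \<Rightarrow> nat \<Rightarrow> real" where
  "weight_delta W f n =
     (\<Sum>k=1..n. \<Sum>j=1..n. \<bar>W n (real k / real n) (real j / real n)\<bar> *
                          f n (real k / real n) (real j / real n))"

end

theory Submission
  imports Defs
begin

text \<open>Write \<open>T\<^sub>z = S\<^sub>z - E S\<^sub>z\<close>, where \<open>S\<^sub>z\<close> is the double sum
\<open>\<Sum> W\<^sub>k\<^sub>j \<gamma>\<^sub>k(x) \<gamma>\<^sub>j(y)\<close> at the frequency \<open>z = (x, y)\<close>. The degenerate part is the mixture of the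
\<open>S\<^sub>z\<close> with weights \<open>g(z)\<close>, so by the Cauchy--Schwarz inequality and Fubini's theorem
(\<open>variance_of_mixture\<close>) it is enough to know that \<open>E |T\<^sub>z|\<^sup>2\<close> is at most a constant times
\<open>(1 + |z| powr \<eta>) W\<^sub>(\<^sub>n\<^sub>)\<close>: the factor is integrable against \<open>|g|\<close> because \<open>H\<^sup>*\<close> lies in the
Wiener ring of order \<open>\<eta>\<close>.

Expanding the square turns \<open>E |T\<^sub>z|\<^sup>2\<close> into a quadratic form in the weights whose kernel is the
covariance of \<open>\<gamma>\<^sub>k(x) \<gamma>\<^sub>j(y)\<close> and \<open>\<gamma>\<^sub>l(x) \<gamma>\<^sub>m(y)\<close>. That covariance decays geometrically in
\<open>min (|k-l| + |j-m|) (|k-m| + |j-l|)\<close> (\<open>covariance_bound\<close>): four points on a line can always be cut,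
by a gap comparable with this quantity, so that either one point is isolated or the two pairs are
separated (\<open>cut_exists\<close>). Across a gap, two groups of factors are almost independent. In the first
case the product then has nearly zero mean, the factors being centred, and in the second the covariance
nearly vanishes. The kernel therefore has bounded row sums, and Schur's test bounds the form by a
multiple of \<open>W\<^sub>(\<^sub>n\<^sub>)\<close>. Since \<open>\<Delta>\<^sub>n\<close> is nonnegative for \<open>n \<ge> 2\<close> (\<open>weight_delta_nonneg\<close>), this is within
the claimed rate.

Near independence across a gap comes from a coupling: the innovations up to the gap are replaced by
their independent copies in the later factors (\<open>cut_decoupling\<close>). The dependence measure controls
the replacement of a single innovation; summing a geometric series and letting the number of replaced
innovations tend to infinity controls the replacement of the whole past
(\<open>moment_le_refreshed_difference\<close>). The estimate passes from the process to
\<open>L(X) exp(ixX)\<close> through the mean value theorem for \<open>L\<close> and Hoelder continuity of order \<open>\<eta>\<close>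
for the exponential, which is where the factor \<open>1 + |x| powr \<eta>\<close> arises
(\<open>oscillation_coupling\<close>).\<close>

section \<open>Moment bounds\<close>

text \<open>The bound \<open>A\<close> is required to be positive so that variables can be normalised by it; this
reduces every norm inequality below to a pointwise inequality between normalised variables.\<close>

definition moment_le ::
    "'a measure \<Rightarrow> nat \<Rightarrow> ('a \<Rightarrow> 'b::{banach, second_countable_topology}) \<Rightarrow> real \<Rightarrow> bool" where
  "moment_le M p Y A \<longleftrightarrow>
     Y \<in> borel_measurable M \<and> 0 < A \<and> (\<integral>\<^sup>+\<omega>. ennreal (norm (Y \<omega>) ^ p) \<partial>M) \<le> ennreal (A ^ p)"

lemma moment_le_measurable: "moment_le M p Y A \<Longrightarrow> Y \<in> borel_measurable M"
  and moment_le_pos: "moment_le M p Y A \<Longrightarrow> 0 < A"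
  by (simp_all add: moment_le_def)

lemma moment_le_normalised:
  assumes [measurable]: "Y \<in> borel_measurable M" and "0 < A"
  shows "moment_le M p Y A \<longleftrightarrow> (\<integral>\<^sup>+\<omega>. ennreal ((norm (Y \<omega>) / A) ^ p) \<partial>M) \<le> 1"
proof -
  have "(\<integral>\<^sup>+\<omega>. ennreal (norm (Y \<omega>) ^ p) \<partial>M)
      = (\<integral>\<^sup>+\<omega>. ennreal (A ^ p) * ennreal ((norm (Y \<omega>) / A) ^ p) \<partial>M)"
    using \<open>0 < A\<close> by (intro nn_integral_cong) (simp flip: ennreal_mult add: power_divide)
  also have "\<dots> = ennreal (A ^ p) * (\<integral>\<^sup>+\<omega>. ennreal ((norm (Y \<omega>) / A) ^ p) \<partial>M)"
    by (intro nn_integral_cmult) measurable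
  finally have eq: "(\<integral>\<^sup>+\<omega>. ennreal (norm (Y \<omega>) ^ p) \<partial>M) = \<dots>" .
  have "ennreal (A ^ p) * c \<le> ennreal (A ^ p) \<longleftrightarrow> c \<le> 1" for c
    using \<open>0 < A\<close> ennreal_mult_le_mult_iff[of "ennreal (A ^ p)" c 1] by simp
  then show ?thesis
    using assms by (simp add: moment_le_def eq)
qed

text \<open>Hoelder's and Minkowski's inequalities both integrate a pointwise convexity inequality between
normalised variables, and this lemma performs the integration once for all of them.\<close>

lemma moment_le_combine:
  assumes X: "moment_le M p X A" and Y: "moment_le M q Y B"
    and Z[measurable]: "Z \<in> borel_measurable M" and pos: "0 < C" "0 \<le> a" "0 \<le> b" "a + b \<le> 1"
    and le: "\<And>\<omega>. (norm (Z \<omega>) / C) ^ r \<le> a * (norm (X \<omega>) / A) ^ p + b * (norm (Y \<omega>) / B) ^ q"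
  shows "moment_le M r Z C"
proof -
  note [measurable] = moment_le_measurable[OF X] moment_le_measurable[OF Y]
  have AB: "0 < A" "0 < B" using X Y by (auto dest: moment_le_pos)
  have "(\<integral>\<^sup>+\<omega>. ennreal ((norm (Z \<omega>) / C) ^ r) \<partial>M)
      \<le> (\<integral>\<^sup>+\<omega>. ennreal a * ennreal ((norm (X \<omega>) / A) ^ p) +
              ennreal b * ennreal ((norm (Y \<omega>) / B) ^ q) \<partial>M)"
    using le pos AB by (intro nn_integral_mono) (simp flip: ennreal_mult ennreal_plus add: ennreal_leI)
  also have "\<dots> = ennreal a * (\<integral>\<^sup>+\<omega>. ennreal ((norm (X \<omega>) / A) ^ p) \<partial>M) +
              ennreal b * (\<integral>\<^sup>+\<omega>. ennreal ((norm (Y \<omega>) / B) ^ q) \<partial>M)"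
    by (simp add: nn_integral_add nn_integral_cmult)
  also have "\<dots> \<le> ennreal a * 1 + ennreal b * 1"
    using X Y AB by (intro add_mono mult_left_mono) (auto simp: moment_le_normalised)
  also have "\<dots> \<le> 1" using pos by (simp flip: ennreal_plus add: ennreal_le_1)
  finally show ?thesis using pos by (simp add: moment_le_normalised)
qed

lemma moment_le_mono:
  assumes X: "moment_le M p X A" and [measurable]: "Z \<in> borel_measurable M"
    and "A \<le> B" "\<And>\<omega>. norm (Z \<omega>) \<le> norm (X \<omega>)"
  shows "moment_le M p Z B"
proof (rule moment_le_combine[OF X X])
  have "0 < A" using X by (rule moment_le_pos)
  fix \<omega> show "(norm (Z \<omega>) / B) ^ p \<le> 1 * (norm (X \<omega>) / A) ^ p + 0 * (norm (X \<omega>) / A) ^ p"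
    using assms \<open>0 < A\<close> by (simp add: power_mono frac_le)
next
  show "0 < B" using assms moment_le_pos[OF X] by linarith
qed auto

lemma (in prob_space) moment_le_const:
  assumes "norm c \<le> A" "0 < A"
  shows "moment_le M p (\<lambda>_. c) A"
  using assms by (simp add: moment_le_def emeasure_space_1 ennreal_leI power_mono)

lemma moment_le_cmult:
  fixes Y :: "'a \<Rightarrow> 'b::{banach, second_countable_topology, real_normed_div_algebra}"
  assumes Y: "moment_le M p Y A" and "norm c \<le> B" "0 < B"
  shows "moment_le M p (\<lambda>\<omega>. c * Y \<omega>) (B * A)"
proof (rule moment_le_combine[OF Y Y])
  note [measurable] = moment_le_measurable[OF Y]
  have "0 < A" using Y by (rule moment_le_pos)
  then show "0 < B * A" using assms by simp
  show "(\<lambda>\<omega>. c * Y \<omega>) \<in> borel_measurable M" by measurable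
  fix \<omega>
  have "norm (c * Y \<omega>) / (B * A) = (norm c / B) * (norm (Y \<omega>) / A)"
    by (simp add: norm_mult)
  also have "\<dots> \<le> 1 * (norm (Y \<omega>) / A)"
    using assms \<open>0 < A\<close> by (intro mult_right_mono) (auto simp: divide_le_eq)
  finally have "norm (c * Y \<omega>) / (B * A) \<le> norm (Y \<omega>) / A" by simp
  then show "(norm (c * Y \<omega>) / (B * A)) ^ p \<le> 1 * (norm (Y \<omega>) / A) ^ p + 0 * (norm (Y \<omega>) / A) ^ p"
    using \<open>0 < A\<close> \<open>0 < B\<close> by (simp add: power_mono)
qed auto

text \<open>Hoelder's inequality with equal exponents, by the arithmetic--geometric mean inequality.\<close>

lemma moment_le_mult:
  fixes X Y :: "'a \<Rightarrow> 'b::{banach, second_countable_topology, real_normed_div_algebra}"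
  assumes X: "moment_le M (2 * p) X A" and Y: "moment_le M (2 * p) Y B"
  shows "moment_le M p (\<lambda>\<omega>. X \<omega> * Y \<omega>) (A * B)"
proof (rule moment_le_combine[OF X Y])
  note [measurable] = moment_le_measurable[OF X] moment_le_measurable[OF Y]
  have AB: "0 < A" "0 < B" using X Y by (auto dest: moment_le_pos)
  then show "0 < A * B" by simp
  show "(\<lambda>\<omega>. X \<omega> * Y \<omega>) \<in> borel_measurable M" by measurable
  fix \<omega>
  define x y where "x = norm (X \<omega>) / A" and "y = norm (Y \<omega>) / B"
  have "2 * (x ^ p * y ^ p) \<le> (x ^ p)\<^sup>2 + (y ^ p)\<^sup>2"
    using sum_squares_bound[of "x ^ p" "y ^ p"] by simp
  then have "(x * y) ^ p \<le> 1/2 * x ^ (2 * p) + 1/2 * y ^ (2 * p)"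
    by (simp add: power_mult_distrib power_even_eq)
  then show "(norm (X \<omega> * Y \<omega>) / (A * B)) ^ p
      \<le> 1/2 * (norm (X \<omega>) / A) ^ (2 * p) + 1/2 * (norm (Y \<omega>) / B) ^ (2 * p)"
    by (simp add: x_def y_def norm_mult)
qed auto

text \<open>Minkowski's inequality: after normalisation it is convexity of the \<open>p\<close>-th power, with weights
proportional to the two bounds.\<close>

lemma moment_le_add:
  assumes X: "moment_le M p X A" and Y: "moment_le M p Y B" and p: "even p"
  shows "moment_le M p (\<lambda>\<omega>. X \<omega> + Y \<omega>) (A + B)"
proof (rule moment_le_combine[OF X Y])
  note [measurable] = moment_le_measurable[OF X] moment_le_measurable[OF Y]
  have AB: "0 < A" "0 < B" using X Y by (auto dest: moment_le_pos)
  then show "0 < A + B" "0 \<le> A / (A + B)" "0 \<le> B / (A + B)" by auto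
  show w: "A / (A + B) + B / (A + B) \<le> 1" using AB by (simp flip: add_divide_distrib)
  show "(\<lambda>\<omega>. X \<omega> + Y \<omega>) \<in> borel_measurable M" by measurable
  fix \<omega>
  define x y where "x = norm (X \<omega>) / A" and "y = norm (Y \<omega>) / B"
  have "norm (X \<omega> + Y \<omega>) / (A + B) \<le> (norm (X \<omega>) + norm (Y \<omega>)) / (A + B)"
    using AB by (intro divide_right_mono norm_triangle_ineq) auto
  also have "\<dots> = A / (A + B) * x + B / (A + B) * y"
    using AB by (simp add: x_def y_def add_divide_distrib)
  finally have "(norm (X \<omega> + Y \<omega>) / (A + B)) ^ p \<le> (A / (A + B) * x + B / (A + B) * y) ^ p"
    using AB by (intro power_mono) auto
  also have "\<dots> \<le> A / (A + B) * x ^ p + B / (A + B) * y ^ p"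
    using convex_onD[OF convex_power_even[OF p], of "B / (A + B)" x y] AB
    by (simp add: field_simps)
  finally show "(norm (X \<omega> + Y \<omega>) / (A + B)) ^ p
      \<le> A / (A + B) * (norm (X \<omega>) / A) ^ p + B / (A + B) * (norm (Y \<omega>) / B) ^ p"
    by (simp add: x_def y_def)
qed

lemma (in prob_space) moment_le_halve:
  fixes X :: "'a \<Rightarrow> 'b::{banach, second_countable_topology, real_normed_div_algebra}"
  assumes "moment_le M (2 * p) X A"
  shows "moment_le M p X A"
  using moment_le_mult[OF assms moment_le_const[of "1::'b" 1]] by simp

lemma moment_le_1_integral:
  assumes Y: "moment_le M 1 Y A"
  shows "integrable M Y" "norm (\<integral>\<omega>. Y \<omega> \<partial>M) \<le> A"
proof -
  note [measurable] = moment_le_measurable[OF Y]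
  have le: "(\<integral>\<^sup>+\<omega>. ennreal (norm (Y \<omega>)) \<partial>M) \<le> ennreal A"
    using Y by (simp add: moment_le_def)
  then show int: "integrable M Y"
    by (intro integrableI_bounded) (auto intro: le_less_trans)
  have "ennreal (norm (\<integral>\<omega>. Y \<omega> \<partial>M)) \<le> ennreal A"
    using integral_norm_bound_ennreal[OF int] le by (rule order_trans)
  then show "norm (\<integral>\<omega>. Y \<omega> \<partial>M) \<le> A"
    using moment_le_pos[OF Y] by (simp add: ennreal_le_iff)
qed

section \<open>Families selected from i.i.d. variables\<close>

abbreviation seq_space :: "('i \<Rightarrow> real) measure" where
  "seq_space \<equiv> \<Pi>\<^sub>M i\<in>UNIV. borel"

lemma measurable_seq_space:
  assumes "\<And>i. (\<lambda>x. f x i) \<in> borel_measurable M"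
  shows "f \<in> M \<rightarrow>\<^sub>M seq_space"
  using assms by (intro measurable_PiM_single') (auto simp: space_PiM)

text \<open>The index type is kept abstract: it will be the sum of two copies of the integers, one for
the innovations and one for their independent copies, so that every coupling is a choice of indices.\<close>

locale iid_family = prob_space M for M :: "'a measure" +
  fixes E :: "'i \<Rightarrow> 'a \<Rightarrow> real" and \<nu> :: "real measure"
  assumes indep: "indep_vars (\<lambda>_. borel) E UNIV"
    and law: "distr M borel (E i) = \<nu>"
begin

definition select :: "('j \<Rightarrow> 'i) \<Rightarrow> 'a \<Rightarrow> 'j \<Rightarrow> real" where
  "select \<sigma> \<omega> = (\<lambda>j. E (\<sigma> j) \<omega>)"

lemma E_measurable [measurable]: "E i \<in> borel_measurable M"
  using indep by (simp add: indep_vars_def)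

lemma select_measurable [measurable]: "select \<sigma> \<in> M \<rightarrow>\<^sub>M seq_space"
  by (rule measurable_seq_space) (simp add: select_def)

text \<open>Selecting along an injection gives a sequence with the same product law, whichever indices are
selected. All identities in law between coupled processes are instances of this fact.\<close>

lemma distr_select:
  fixes \<sigma> :: "'j \<Rightarrow> 'i"
  assumes "inj \<sigma>"
  shows "distr M seq_space (select \<sigma>) = (\<Pi>\<^sub>M j\<in>UNIV. \<nu>)"
proof -
  have nu: "sets \<nu> = sets borel" "prob_space \<nu>"
    using law[of undefined, symmetric] by (auto intro: prob_space_distr)
  have all: "distr M seq_space (select id) = (\<Pi>\<^sub>M i\<in>UNIV. \<nu>)"
    using indep indep_vars_iff_distr_eq_PiM[where I = UNIV and M' = "\<lambda>_. borel" and X = E]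
    by (simp add: law select_def[abs_def] restrict_UNIV)
  have comp: "(\<lambda>x. x \<circ> \<sigma>) \<in> seq_space \<rightarrow>\<^sub>M (seq_space :: ('j \<Rightarrow> real) measure)"
    by (rule measurable_seq_space) simp
  have "distr M seq_space (select \<sigma>) = distr (distr M seq_space (select id)) seq_space (\<lambda>x. x \<circ> \<sigma>)"
    by (subst distr_distr[OF comp select_measurable]) (auto simp: select_def[abs_def] o_def)
  also have "\<dots> = distr (\<Pi>\<^sub>M i\<in>UNIV. \<nu>) (\<Pi>\<^sub>M j\<in>UNIV. \<nu>) (\<lambda>x. \<lambda>j\<in>UNIV. x (\<sigma> j))"
    unfolding all by (rule distr_cong) (auto simp: o_def nu intro!: sets_PiM_cong)
  also have "\<dots> = (\<Pi>\<^sub>M j\<in>UNIV. \<nu>)"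
    using assms nu by (intro distr_PiM_reindex) auto
  finally show ?thesis .
qed

lemma nn_integral_select:
  fixes \<sigma> \<tau> :: "'j \<Rightarrow> 'i"
  assumes "inj \<sigma>" "inj \<tau>" and [measurable]: "\<Phi> \<in> borel_measurable seq_space"
  shows "(\<integral>\<^sup>+\<omega>. \<Phi> (select \<sigma> \<omega>) \<partial>M) = (\<integral>\<^sup>+\<omega>. \<Phi> (select \<tau> \<omega>) \<partial>M)"
proof -
  have "distr M seq_space (select \<sigma>) = distr M seq_space (select \<tau>)"
    using assms by (simp add: distr_select)
  then show ?thesis
    using nn_integral_distr[of "select \<sigma>" M seq_space \<Phi>] nn_integral_distr[of "select \<tau>" M seq_space \<Phi>]
    by simp
qed

lemma integral_select:
  fixes \<sigma> \<tau> :: "'j \<Rightarrow> 'i" and \<Phi> :: "('j \<Rightarrow> real) \<Rightarrow> 'b::{banach, second_countable_topology}"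
  assumes "inj \<sigma>" "inj \<tau>" and [measurable]: "\<Phi> \<in> borel_measurable seq_space"
  shows "(\<integral>\<omega>. \<Phi> (select \<sigma> \<omega>) \<partial>M) = (\<integral>\<omega>. \<Phi> (select \<tau> \<omega>) \<partial>M)"
proof -
  have "distr M seq_space (select \<sigma>) = distr M seq_space (select \<tau>)"
    using assms by (simp add: distr_select)
  then show ?thesis
    using integral_distr[of "select \<sigma>" M seq_space \<Phi>] integral_distr[of "select \<tau>" M seq_space \<Phi>]
    by simp
qed

lemma prob_select:
  fixes \<sigma> :: "'j \<Rightarrow> 'i"
  assumes "inj \<sigma>" "A \<in> sets seq_space"
  shows "prob (select \<sigma> -` A \<inter> space M) = measure (\<Pi>\<^sub>M j\<in>UNIV. \<nu>) A"
  using assms by (simp flip: distr_select[OF \<open>inj \<sigma>\<close>] add: measure_distr)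

lemma moment_le_select:
  fixes \<sigma> \<tau> :: "'j \<Rightarrow> 'i" and \<Phi> :: "('j \<Rightarrow> real) \<Rightarrow> 'b::{banach, second_countable_topology}"
  assumes "inj \<sigma>" "inj \<tau>" and [measurable]: "\<Phi> \<in> borel_measurable seq_space"
    and "moment_le M p (\<lambda>\<omega>. \<Phi> (select \<sigma> \<omega>)) A"
  shows "moment_le M p (\<lambda>\<omega>. \<Phi> (select \<tau> \<omega>)) A"
  using assms nn_integral_select[OF assms(1,2), of "\<lambda>x. ennreal (norm (\<Phi> x) ^ p)"]
  by (simp add: moment_le_def)

lemma indep_select:
  fixes u :: "('j \<Rightarrow> real) \<Rightarrow> 'b::{real_normed_field, banach, second_countable_topology}"
  fixes v :: "('k \<Rightarrow> real) \<Rightarrow> 'b"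
  assumes "range \<sigma> \<inter> range \<tau> = {}"
    and [measurable]: "u \<in> borel_measurable seq_space" "v \<in> borel_measurable seq_space"
    and "integrable M (\<lambda>\<omega>. u (select \<sigma> \<omega>))" "integrable M (\<lambda>\<omega>. v (select \<tau> \<omega>))"
  shows "(\<integral>\<omega>. u (select \<sigma> \<omega>) * v (select \<tau> \<omega>) \<partial>M) =
    (\<integral>\<omega>. u (select \<sigma> \<omega>) \<partial>M) * (\<integral>\<omega>. v (select \<tau> \<omega>) \<partial>M)"
proof -
  let ?R = "\<lambda>A \<omega>. restrict (\<lambda>i. E i \<omega>) A"
  have pick: "(\<lambda>x j. x (\<rho> j)) \<in> (\<Pi>\<^sub>M i\<in>range \<rho>. borel) \<rightarrow>\<^sub>M seq_space" for \<rho> :: "'l \<Rightarrow> 'i"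
    by (rule measurable_seq_space) simp
  have "indep_var borel ((\<lambda>x. u (\<lambda>j. x (\<sigma> j))) \<circ> ?R (range \<sigma>)) borel ((\<lambda>x. v (\<lambda>j. x (\<tau> j))) \<circ> ?R (range \<tau>))"
    using assms(1)
    by (intro indep_var_compose[OF indep_var_restrict[OF indep]] measurable_compose[OF pick]) auto
  then have "indep_var borel (\<lambda>\<omega>. u (select \<sigma> \<omega>)) borel (\<lambda>\<omega>. v (select \<tau> \<omega>))"
    by (simp add: o_def select_def)
  then show ?thesis using assms by (intro indep_var_lebesgue_integral)
qed

text \<open>The selected sequences converge coordinate by coordinate in the discrete sense, which says nothing
pathwise about a set depending on infinitely many coordinates. The sets for which the disagreement
vanishes in the limit do, however, form a \<open>\<sigma>\<close>-algebra containing the sets that depend on a single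
coordinate: for countable unions the tails are small
uniformly in \<open>N\<close>, because all selections have the same law.\<close>

lemma select_disagreement_tendsto_0:
  fixes \<sigma> :: "nat \<Rightarrow> 'j \<Rightarrow> 'i"
  assumes inj: "\<And>N. inj (\<sigma> N)" "inj \<tau>"
    and ev: "\<And>j. \<forall>\<^sub>F N in sequentially. \<sigma> N j = \<tau> j"
    and A: "A \<in> sets seq_space"
  shows "(\<lambda>N. prob {\<omega>\<in>space M. (select (\<sigma> N) \<omega> \<in> A) \<noteq> (select \<tau> \<omega> \<in> A)}) \<longlonglongrightarrow> 0"
proof -
  let ?D = "\<lambda>A N. {\<omega>\<in>space M. (select (\<sigma> N) \<omega> \<in> A) \<noteq> (select \<tau> \<omega> \<in> A)}"
  have D_sets: "?D A N \<in> sets M" if [measurable]: "A \<in> sets seq_space" for A N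
    by measurable
  let ?gen = "{{f \<in> \<Pi>\<^sub>E i\<in>UNIV. space borel. f i \<in> A} | i A. i \<in> UNIV \<and> A \<in> sets borel}
    :: ('j \<Rightarrow> real) set set"
  have gen: "sets seq_space = sigma_sets UNIV ?gen"
    by (subst sets_PiM_single) simp
  from A have "A \<in> sigma_sets UNIV ?gen" by (simp only: gen)
  then show ?thesis
  proof induction
    case (Basic A)
    then obtain j B where A: "A = {f. f j \<in> B}" by auto
    have "\<forall>\<^sub>F N in sequentially. ?D A N = {}"
      using ev[of j] by eventually_elim (auto simp: A select_def)
    then have "\<forall>\<^sub>F N in sequentially. prob (?D A N) = 0"
      by eventually_elim (simp only: measure_empty)
    then show ?case by (rule tendsto_eventually)
  next
    case Empty
    then show ?case by simp
  next
    case (Compl A)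
    then show ?case by (simp add: not_iff) 
  next
    case (Union B)
    have B[measurable]: "B i \<in> sets seq_space" for i using Union gen by blast
    define C where "C m = (\<Union>i<m. B i)" for m
    define T where "T m = (\<Union>i. B i) - C m" for m
    have [measurable]: "T m \<in> sets seq_space" "C m \<in> sets seq_space" for m
      by (auto simp: T_def C_def)
    let ?\<mu> = "\<Pi>\<^sub>M j\<in>UNIV. \<nu> :: ('j \<Rightarrow> real) measure"
    have mu: "?\<mu> = distr M seq_space (select \<tau>)" using distr_select[OF inj(2)] ..
    interpret mu: prob_space ?\<mu> unfolding mu by (rule prob_space_distr) simp
    have "(\<lambda>m. measure ?\<mu> (T m)) \<longlonglongrightarrow> measure ?\<mu> (\<Inter>m. T m)"
      by (intro mu.finite_Lim_measure_decseq)
        (auto simp: mu, force simp: T_def C_def decseq_def)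
    also have "(\<Inter>m. T m) = {}" by (auto simp: T_def C_def)
    finally have tail: "(\<lambda>m. measure ?\<mu> (T m)) \<longlonglongrightarrow> 0" by simp
    show ?case
    proof (rule LIMSEQ_I)
      fix e :: real assume "0 < e"
      then obtain m where m: "measure ?\<mu> (T m) < e / 4"
        using LIMSEQ_D[OF tail, of "e / 4"] by auto
      have "(\<lambda>N. \<Sum>i<m. prob (?D (B i) N)) \<longlonglongrightarrow> (\<Sum>i<m. 0)"
        by (intro tendsto_sum Union.IH)
      then have "\<forall>\<^sub>F N in sequentially. (\<Sum>i<m. prob (?D (B i) N)) < e / 2"
        using \<open>0 < e\<close> by (intro order_tendstoD) auto
      then obtain N0 where N0: "\<And>N. N \<ge> N0 \<Longrightarrow> (\<Sum>i<m. prob (?D (B i) N)) < e / 2"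
        by (auto simp: eventually_sequentially)
      have "norm (prob (?D (\<Union> (range B)) N) - 0) < e" if "N \<ge> N0" for N
      proof -
        let ?P = "\<lambda>\<rho>. select \<rho> -` T m \<inter> space M"
        have P: "?P \<rho> \<in> sets M" for \<rho> by (rule measurable_sets[OF select_measurable]) measurable
        have "prob (?D (\<Union> (range B)) N) \<le> prob ((\<Union>i<m. ?D (B i) N) \<union> (?P (\<sigma> N) \<union> ?P \<tau>))"
          by (intro finite_measure_mono) (auto simp: T_def C_def D_sets intro!: sets.Un P)
        also have "\<dots> \<le> prob (\<Union>i<m. ?D (B i) N) + prob (?P (\<sigma> N) \<union> ?P \<tau>)"
          by (intro measure_Un_le sets.finite_UN sets.Un P D_sets) auto
        also have "prob (\<Union>i<m. ?D (B i) N) \<le> (\<Sum>i<m. prob (?D (B i) N))"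
          by (intro measure_UNION_le) (auto simp: D_sets)
        also have "prob (?P (\<sigma> N) \<union> ?P \<tau>) \<le> prob (?P (\<sigma> N)) + prob (?P \<tau>)"
          by (intro measure_Un_le P)
        also have "\<dots> = 2 * measure ?\<mu> (T m)"
          using inj by (simp add: prob_select)
        finally show ?thesis using m N0[OF that] by simp
      qed
      then show "\<exists>no. \<forall>N\<ge>no. norm (prob (?D (\<Union> (range B)) N) - 0) < e" by blast
    qed
  qed
qed

text \<open>Extends the previous lemma from sets to integrable functions. The approximation error of a
dominated sequence is again uniform in \<open>N\<close>, since it depends only on the common law.\<close>

lemma select_L1_tendsto:
  fixes \<sigma> :: "nat \<Rightarrow> 'j \<Rightarrow> 'i" and h :: "('j \<Rightarrow> real) \<Rightarrow> real"
  assumes inj: "\<And>N. inj (\<sigma> N)" "inj \<tau>"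
    and ev: "\<And>j. \<forall>\<^sub>F N in sequentially. \<sigma> N j = \<tau> j"
    and h: "integrable (\<Pi>\<^sub>M j\<in>UNIV. \<nu>) h"
  shows "(\<lambda>N. \<integral>\<omega>. norm (h (select (\<sigma> N) \<omega>) - h (select \<tau> \<omega>)) \<partial>M) \<longlonglongrightarrow> 0"
  using h
proof (induction rule: integrable_induct)
  let ?\<mu> = "\<Pi>\<^sub>M j\<in>UNIV. \<nu> :: ('j \<Rightarrow> real) measure"
  have mu: "?\<mu> = distr M seq_space (select \<rho>)" if "inj \<rho>" for \<rho>
    using distr_select[OF that] ..
  have int: "integrable M (\<lambda>\<omega>. f (select \<rho> \<omega>))" if "integrable ?\<mu> f" "inj \<rho>" for f :: "_ \<Rightarrow> real" and \<rho>
    using that(1) unfolding mu[OF that(2)] by (intro integrable_distr[of "select \<rho>" M seq_space]) auto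
  have eq: "(\<integral>\<omega>. norm (f (select \<rho> \<omega>)) \<partial>M) = (\<integral>x. norm (f x) \<partial>?\<mu>)"
    if "integrable ?\<mu> f" "inj \<rho>" for f :: "_ \<Rightarrow> real" and \<rho>
    using borel_measurable_integrable[OF that(1)] unfolding mu[OF that(2)]
    by (subst integral_distr) auto
  {
    case (base A c)
    then have A[measurable]: "A \<in> sets seq_space" by (simp add: mu[OF inj(2)])
    have "(\<lambda>N. \<bar>c\<bar> * prob {\<omega>\<in>space M. (select (\<sigma> N) \<omega> \<in> A) \<noteq> (select \<tau> \<omega> \<in> A)}) \<longlonglongrightarrow> \<bar>c\<bar> * 0"
      by (intro tendsto_mult tendsto_const select_disagreement_tendsto_0 inj ev A)
    moreover have "(\<integral>\<omega>. norm (indicator A (select (\<sigma> N) \<omega>) *\<^sub>R c - indicator A (select \<tau> \<omega>) *\<^sub>R c) \<partial>M)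
        = \<bar>c\<bar> * prob {\<omega>\<in>space M. (select (\<sigma> N) \<omega> \<in> A) \<noteq> (select \<tau> \<omega> \<in> A)}" for N
    proof -
      let ?S = "{\<omega>\<in>space M. (select (\<sigma> N) \<omega> \<in> A) \<noteq> (select \<tau> \<omega> \<in> A)}"
      have "(\<integral>\<omega>. norm (indicator A (select (\<sigma> N) \<omega>) *\<^sub>R c - indicator A (select \<tau> \<omega>) *\<^sub>R c) \<partial>M)
          = (\<integral>\<omega>. \<bar>c\<bar> * indicator ?S \<omega> \<partial>M)"
        by (intro Bochner_Integration.integral_cong) (auto simp: indicator_def)
      also have "\<dots> = \<bar>c\<bar> * prob ?S" by (simp add: Int_absorb1 subset_iff)
      finally show ?thesis .
    qed
    ultimately show ?case by simp
  next
    case (add f g)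
    show ?case
    proof (rule Lim_null_comparison)
      show "(\<lambda>N. (\<integral>\<omega>. norm (f (select (\<sigma> N) \<omega>) - f (select \<tau> \<omega>)) \<partial>M) +
          (\<integral>\<omega>. norm (g (select (\<sigma> N) \<omega>) - g (select \<tau> \<omega>)) \<partial>M)) \<longlonglongrightarrow> 0"
        using tendsto_add[OF add.IH] by simp
      show "\<forall>\<^sub>F N in sequentially. norm (\<integral>\<omega>. norm (f (select (\<sigma> N) \<omega>) + g (select (\<sigma> N) \<omega>) - (f (select \<tau> \<omega>) + g (select \<tau> \<omega>))) \<partial>M)
        \<le> (\<integral>\<omega>. norm (f (select (\<sigma> N) \<omega>) - f (select \<tau> \<omega>)) \<partial>M) +
          (\<integral>\<omega>. norm (g (select (\<sigma> N) \<omega>) - g (select \<tau> \<omega>)) \<partial>M)"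
        using add.hyps inj
        by (intro always_eventually allI, subst Bochner_Integration.integral_add[symmetric])
          (auto intro!: integral_mono int integrable_norm Bochner_Integration.integrable_add Bochner_Integration.integrable_diff)
    qed
  next
    case (lim f s)
    have fm: "f \<in> borel_measurable ?\<mu>" "\<And>i. s i \<in> borel_measurable ?\<mu>"
      using lim by auto
    have "(\<lambda>i. \<integral>x. norm (s i x - f x) \<partial>?\<mu>) \<longlonglongrightarrow> (\<integral>x. norm (0::real) \<partial>?\<mu>)"
    proof (rule integral_dominated_convergence)
      show "integrable ?\<mu> (\<lambda>x. 3 * norm (f x))" using lim by simp
      show "AE x in ?\<mu>. (\<lambda>i. norm (s i x - f x)) \<longlonglongrightarrow> norm (0::real)"
        using lim.hyps(2) by (intro AE_I2 tendsto_norm LIM_zero) auto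
      show "AE x in ?\<mu>. norm (norm (s i x - f x)) \<le> 3 * norm (f x)" for i
        using lim.hyps(3) by (intro AE_I2) (fastforce intro: order_trans[OF abs_triangle_ineq4])
    qed (use fm in auto)
    then have approx: "(\<lambda>i. \<integral>x. norm (s i x - f x) \<partial>?\<mu>) \<longlonglongrightarrow> 0" by simp
    show ?case
    proof (rule LIMSEQ_I)
      fix e :: real assume "0 < e"
      then obtain i where i: "(\<integral>x. norm (s i x - f x) \<partial>?\<mu>) < e / 4"
        using LIMSEQ_D[OF approx, of "e / 4"] by force
      obtain N0 where N0: "\<And>N. N \<ge> N0 \<Longrightarrow>
          norm ((\<integral>\<omega>. norm (s i (select (\<sigma> N) \<omega>) - s i (select \<tau> \<omega>)) \<partial>M) - 0) < e / 2"
        using LIMSEQ_D[OF lim.IH[of i], of "e / 2"] \<open>0 < e\<close> by auto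
      have "norm ((\<integral>\<omega>. norm (f (select (\<sigma> N) \<omega>) - f (select \<tau> \<omega>)) \<partial>M) - 0) < e" if "N \<ge> N0" for N
      proof -
        have d: "integrable ?\<mu> (\<lambda>x. s i x - f x)" using lim by auto
        note ints = int[OF lim.hyps(4)] int[OF lim.hyps(1)]
        have "(\<integral>\<omega>. norm (f (select (\<sigma> N) \<omega>) - f (select \<tau> \<omega>)) \<partial>M)
          \<le> (\<integral>\<omega>. norm (s i (select (\<sigma> N) \<omega>) - f (select (\<sigma> N) \<omega>)) +
               (norm (s i (select (\<sigma> N) \<omega>) - s i (select \<tau> \<omega>)) + norm (s i (select \<tau> \<omega>) - f (select \<tau> \<omega>))) \<partial>M)"
          using inj by (intro integral_mono) (auto intro!: ints integrable_norm Bochner_Integration.integrable_add Bochner_Integration.integrable_diff)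
        also have "\<dots> = (\<integral>\<omega>. norm (s i (select (\<sigma> N) \<omega>) - f (select (\<sigma> N) \<omega>)) \<partial>M) +
               ((\<integral>\<omega>. norm (s i (select (\<sigma> N) \<omega>) - s i (select \<tau> \<omega>)) \<partial>M) + (\<integral>\<omega>. norm (s i (select \<tau> \<omega>) - f (select \<tau> \<omega>)) \<partial>M))"
          using inj by (subst Bochner_Integration.integral_add Bochner_Integration.integral_add; (subst Bochner_Integration.integral_add)?)
            (auto intro!: ints integrable_norm Bochner_Integration.integrable_add Bochner_Integration.integrable_diff)
        also have "\<dots> < e"
          using eq[OF d] inj i N0[OF that] by simp
        finally show ?thesis by simp
      qed
      then show "\<exists>no. \<forall>N\<ge>no. norm ((\<integral>\<omega>. norm (f (select (\<sigma> N) \<omega>) - f (select \<tau> \<omega>)) \<partial>M) - 0) < e" by blast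
    qed
  }
qed

text \<open>A moment bound survives the passage from finitely to infinitely many replaced coordinates. No
integrability of \<open>G\<close> is available, so convergence is first obtained for the bounded function
\<open>arctan \<circ> G\<close>; along a subsequence it holds almost surely, can be inverted by the tangent, and
Fatou's lemma applies.\<close>

lemma moment_le_select_limit:
  fixes \<sigma> :: "nat \<Rightarrow> 'j \<Rightarrow> 'i" and G :: "('j \<Rightarrow> real) \<Rightarrow> real"
  assumes inj: "\<And>N. inj (\<sigma> N)" "inj \<tau>"
    and ev: "\<And>j. \<forall>\<^sub>F N in sequentially. \<sigma> N j = \<tau> j"
    and [measurable]: "G \<in> borel_measurable seq_space"
    and bound: "\<And>N. moment_le M p (\<lambda>\<omega>. Y \<omega> - G (select (\<sigma> N) \<omega>)) A"
    and [measurable]: "Y \<in> borel_measurable M"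
  shows "moment_le M p (\<lambda>\<omega>. Y \<omega> - G (select \<tau> \<omega>)) A"
proof -
  let ?\<mu> = "\<Pi>\<^sub>M j\<in>UNIV. \<nu> :: ('j \<Rightarrow> real) measure"
  have mu: "?\<mu> = distr M seq_space (select \<tau>)" using distr_select[OF inj(2)] ..
  interpret mu: prob_space ?\<mu> unfolding mu by (rule prob_space_distr) simp
  have [simp, measurable_cong]: "sets ?\<mu> = sets seq_space" by (simp add: mu)
  have bounded: "\<bar>arctan x\<bar> \<le> 2" for x
    using arctan_bounded[of x] pi_less_4 by linarith
  have "integrable ?\<mu> (\<lambda>x. arctan (G x))"
    by (rule mu.integrable_const_bound[where B = 2]) (auto simp: bounded)
  then have L1: "(\<lambda>N. \<integral>\<omega>. norm (arctan (G (select (\<sigma> N) \<omega>)) - arctan (G (select \<tau> \<omega>))) \<partial>M) \<longlonglongrightarrow> 0"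
    by (intro select_L1_tendsto inj ev)
  have "integrable M (\<lambda>\<omega>. arctan (G (select \<rho> \<omega>)))" for \<rho>
    by (rule integrable_const_bound[where B = 2]) (auto simp: bounded)
  then obtain r where "strict_mono r"
    and ae: "AE \<omega> in M. (\<lambda>N. arctan (G (select (\<sigma> (r N)) \<omega>)) - arctan (G (select \<tau> \<omega>))) \<longlonglongrightarrow> 0"
    using tendsto_L1_AE_subseq[OF _ L1] by auto
  have "AE \<omega> in M. (\<lambda>N. G (select (\<sigma> (r N)) \<omega>)) \<longlonglongrightarrow> G (select \<tau> \<omega>)"
    using ae
  proof eventually_elim
    case (elim \<omega>)
    then have "(\<lambda>N. arctan (G (select (\<sigma> (r N)) \<omega>))) \<longlonglongrightarrow> arctan (G (select \<tau> \<omega>))"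
      by (rule LIM_zero_cancel)
    then have "(\<lambda>N. tan (arctan (G (select (\<sigma> (r N)) \<omega>)))) \<longlonglongrightarrow> tan (arctan (G (select \<tau> \<omega>)))"
      by (intro isCont_tendsto_compose[OF isCont_tan]) auto
    then show ?case by (simp add: tan_arctan)
  qed
  then have "AE \<omega> in M. ennreal (norm (Y \<omega> - G (select \<tau> \<omega>)) ^ p)
      = liminf (\<lambda>N. ennreal (norm (Y \<omega> - G (select (\<sigma> (r N)) \<omega>)) ^ p))"
  proof eventually_elim
    case (elim \<omega>)
    then have "(\<lambda>N. ennreal (norm (Y \<omega> - G (select (\<sigma> (r N)) \<omega>)) ^ p))
        \<longlonglongrightarrow> ennreal (norm (Y \<omega> - G (select \<tau> \<omega>)) ^ p)"
      by (intro tendsto_ennrealI tendsto_power tendsto_norm tendsto_diff tendsto_const)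
    then show ?case by (intro lim_imp_Liminf[symmetric]) auto
  qed
  then have "(\<integral>\<^sup>+\<omega>. ennreal (norm (Y \<omega> - G (select \<tau> \<omega>)) ^ p) \<partial>M)
      = (\<integral>\<^sup>+\<omega>. liminf (\<lambda>N. ennreal (norm (Y \<omega> - G (select (\<sigma> (r N)) \<omega>)) ^ p)) \<partial>M)"
    by (rule nn_integral_cong_AE)
  also have "\<dots> \<le> liminf (\<lambda>N. \<integral>\<^sup>+\<omega>. ennreal (norm (Y \<omega> - G (select (\<sigma> (r N)) \<omega>)) ^ p) \<partial>M)"
    by (intro nn_integral_liminf) auto
  also have "\<dots> \<le> liminf (\<lambda>N. ennreal (A ^ p))"
    using bound by (intro Liminf_mono always_eventually) (simp add: moment_le_def)
  also have "\<dots> = ennreal (A ^ p)" by (simp add: Liminf_const)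
  finally show ?thesis
    using bound[of 0] by (simp add: moment_le_def)
qed

end

section \<open>Refreshing the remote past\<close>

locale innovations = prob_space M for M :: "'a measure" +
  fixes eps eps' :: "int \<Rightarrow> 'a \<Rightarrow> real"
  assumes iid: "iid_with_copy M eps eps'"

sublocale innovations \<subseteq> iid_family M "case_sum eps eps'" "distr M borel (eps 0)"
  using iid by unfold_locales (auto simp: iid_with_copy_def split: sum.split)

context innovations
begin

definition refreshed_history :: "int \<Rightarrow> int \<Rightarrow> 'a \<Rightarrow> nat \<Rightarrow> real" where
  "refreshed_history s k =
     select (\<lambda>i. if k - int i \<le> s then Inr (k - int i) else Inl (k - int i))"

lemma history_select: "history eps k = select (\<lambda>i. Inl (k - int i))"
  by (simp add: fun_eq_iff history_def select_def)

lemma history_measurable [measurable]: "history eps k \<in> M \<rightarrow>\<^sub>M seq_space"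
  by (simp add: history_select)

lemma refreshed_history_measurable [measurable]: "refreshed_history s k \<in> M \<rightarrow>\<^sub>M seq_space"
  by (simp add: refreshed_history_def)

lemma moment_le_refreshed_history:
  assumes "moment_le M p (\<lambda>\<omega>. \<phi> (history eps k \<omega>)) A" "\<phi> \<in> borel_measurable seq_space"
  shows "moment_le M p (\<lambda>\<omega>. \<phi> (refreshed_history s k \<omega>)) A"
  using assms unfolding history_select refreshed_history_def
  by (intro moment_le_select[OF _ _ _ assms(1)[unfolded history_select]])
    (auto simp: inj_def split: if_splits)

text \<open>Replacing one coordinate by an unused variable has the same effect in law whatever the other
coordinates are, original or already replaced. The pair consisting of the sequence and the new variable is
coded as one sequence whose entry \<open>0\<close> is the new variable.\<close>

lemma moment_le_refresh_one:
  fixes G :: "(nat \<Rightarrow> real) \<Rightarrow> real" and \<sigma> :: "nat \<Rightarrow> int + int"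
  assumes [measurable]: "G \<in> borel_measurable seq_space"
    and dep: "moment_le M p (\<lambda>\<omega>. G (history eps 0 \<omega>) -
          G (history (eps(- int m := eps' (- int m))) 0 \<omega>)) A"
    and "inj \<sigma>" "j \<notin> range \<sigma>"
  shows "moment_le M p (\<lambda>\<omega>. G (select \<sigma> \<omega>) - G (select (\<sigma>(m := j)) \<omega>)) A"
proof -
  let ?\<Phi> = "\<lambda>x. G (\<lambda>i. x (Suc i)) - G (\<lambda>i. if i = m then x 0 else x (Suc i))"
  let ?\<tau> = "case_nat (Inr (- int m)) (\<lambda>i. Inl (0 - int i)) :: nat \<Rightarrow> int + int"
  have tau: "inj ?\<tau>" by (auto simp: inj_def split: nat.splits)
  have sigma: "inj (case_nat j \<sigma>)"
    using assms by (auto simp: inj_def split: nat.splits)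
  have [measurable]: "(\<lambda>x i. x (Suc i)) \<in> seq_space \<rightarrow>\<^sub>M (seq_space :: (nat \<Rightarrow> real) measure)"
      "(\<lambda>x i. if i = m then x 0 else x (Suc i)) \<in> seq_space \<rightarrow>\<^sub>M (seq_space :: (nat \<Rightarrow> real) measure)"
    by (rule measurable_seq_space, simp)+
  have Phi: "?\<Phi> \<in> borel_measurable seq_space" by measurable
  have "(\<lambda>\<omega>. ?\<Phi> (select ?\<tau> \<omega>)) = (\<lambda>\<omega>. G (history eps 0 \<omega>) -
          G (history (eps(- int m := eps' (- int m))) 0 \<omega>))"
    by (intro ext arg_cong2[where f = "(-)"] arg_cong[where f = G]) (auto simp: select_def history_def)
  moreover have "(\<lambda>\<omega>. ?\<Phi> (select (case_nat j \<sigma>) \<omega>)) = (\<lambda>\<omega>. G (select \<sigma> \<omega>) - G (select (\<sigma>(m := j)) \<omega>))"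
    by (intro ext arg_cong2[where f = "(-)"] arg_cong[where f = G]) (auto simp: select_def)
  ultimately show ?thesis
    using moment_le_select[OF tau sigma Phi, of p A] dep by simp
qed

text \<open>The coordinates are refreshed one after the other, starting with the most recent one; each step
costs one dependence measure, and the costs form a geometric series.\<close>

lemma moment_le_refreshed_difference:
  fixes G :: "(nat \<Rightarrow> real) \<Rightarrow> real"
  assumes G[measurable]: "G \<in> borel_measurable seq_space" and "even p"
    and rho: "0 < \<rho>" "\<rho> < 1" and "s \<le> k"
    and dep: "\<And>m. nat (k - s) \<le> m \<Longrightarrow> moment_le M p (\<lambda>\<omega>. G (history eps 0 \<omega>) -
          G (history (eps(- int m := eps' (- int m))) 0 \<omega>)) (B * \<rho> ^ m)"
  shows "moment_le M p (\<lambda>\<omega>. G (history eps k \<omega>) - G (refreshed_history s k \<omega>))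
    (B * \<rho> ^ nat (k - s) / (1 - \<rho>))"
proof -
  define h where "h = nat (k - s)"
  define \<sigma> :: "nat \<Rightarrow> nat \<Rightarrow> int + int" where
    "\<sigma> N i = (if h \<le> i \<and> i < h + N then Inr (k - int i) else Inl (k - int i))" for N i
  have inj: "inj (\<sigma> N)" for N by (auto simp: inj_def \<sigma>_def split: if_splits)
  have B: "0 < B"
    using moment_le_pos[OF dep[of h]] rho by (simp add: h_def zero_less_mult_iff)
  have step: "moment_le M p (\<lambda>\<omega>. G (select (\<sigma> N) \<omega>) - G (select (\<sigma> (Suc N)) \<omega>)) (B * \<rho> ^ (h + N))" for N
  proof -
    have "\<sigma> (Suc N) = (\<sigma> N)(h + N := Inr (k - int (h + N)))"
      by (auto simp: \<sigma>_def fun_eq_iff)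
    moreover have "moment_le M p (\<lambda>\<omega>. G (select (\<sigma> N) \<omega>) -
        G (select ((\<sigma> N)(h + N := Inr (k - int (h + N)))) \<omega>)) (B * \<rho> ^ (h + N))"
      by (rule moment_le_refresh_one[OF G dep inj]) (auto simp: h_def \<sigma>_def split: if_splits)
    ultimately show ?thesis by simp
  qed
  \<comment> \<open>At least one coordinate is refreshed, so that the bound on the partial sum is positive.\<close>
  have "moment_le M p (\<lambda>\<omega>. G (select (\<sigma> 0) \<omega>) - G (select (\<sigma> (Suc N)) \<omega>))
      (B * \<rho> ^ h * (1 - \<rho> ^ Suc N) / (1 - \<rho>))" for N
  proof (induction N)
    case 0
    show ?case using step[of 0] rho by simp
  next
    case (Suc N)
    have "moment_le M p (\<lambda>\<omega>. (G (select (\<sigma> 0) \<omega>) - G (select (\<sigma> (Suc N)) \<omega>)) +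
       (G (select (\<sigma> (Suc N)) \<omega>) - G (select (\<sigma> (Suc (Suc N))) \<omega>)))
      (B * \<rho> ^ h * (1 - \<rho> ^ Suc N) / (1 - \<rho>) + B * \<rho> ^ (h + Suc N))"
      by (rule moment_le_add[OF Suc.IH step \<open>even p\<close>])
    moreover have "B * \<rho> ^ h * (1 - \<rho> ^ Suc N) / (1 - \<rho>) + B * \<rho> ^ (h + Suc N)
      = B * \<rho> ^ h * (1 - \<rho> ^ Suc (Suc N)) / (1 - \<rho>)"
      using rho by (simp add: power_add field_simps)
    ultimately show ?case by simp
  qed
  then have "moment_le M p (\<lambda>\<omega>. G (select (\<sigma> 0) \<omega>) - G (select (\<sigma> (Suc N)) \<omega>))
      (B * \<rho> ^ h / (1 - \<rho>))" for N
    by (rule moment_le_mono) (use rho B in \<open>auto intro!: divide_right_mono simp: mult_le_cancel_left1\<close>)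
  then have "moment_le M p (\<lambda>\<omega>. G (select (\<sigma> 0) \<omega>) -
      G (select (\<lambda>i. if k - int i \<le> s then Inr (k - int i) else Inl (k - int i)) \<omega>))
      (B * \<rho> ^ h / (1 - \<rho>))"
  proof (rule moment_le_select_limit[where \<sigma> = "\<lambda>N. \<sigma> (Suc N)", rotated 4])
    show "\<forall>\<^sub>F N in sequentially. \<sigma> (Suc N) i = (if k - int i \<le> s then Inr (k - int i) else Inl (k - int i))" for i
      using \<open>s \<le> k\<close> unfolding eventually_sequentially
      by (intro exI[of _ i]) (auto simp: \<sigma>_def h_def nat_le_iff)
  qed (use inj in \<open>auto simp: inj_def split: if_splits\<close>)
  moreover have "select (\<sigma> 0) = history eps k"
    unfolding history_select by (rule arg_cong[where f = select]) (auto simp: \<sigma>_def)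
  ultimately show ?thesis by (simp add: h_def refreshed_history_def)
qed

end

section \<open>Covariances of products of four factors\<close>

text \<open>Order the four points on the line, with consecutive gaps \<open>u\<close>, \<open>v\<close>, \<open>w\<close>, and call
\<open>{a, b}\<close> and \<open>{c, d}\<close> the pairs. A large outer gap \<open>u\<close> or \<open>w\<close> isolates a single point. If the
pairs are separated, then \<open>D = u + 2 * v + w\<close>, so one of the three gaps is at least \<open>D / 4\<close>; if the
pairs interlace or are nested, then \<open>D \<le> u + w\<close> and an outer gap suffices.\<close>

lemma cut_exists:
  fixes a b c d :: int
  defines "D \<equiv> min (\<bar>a - c\<bar> + \<bar>b - d\<bar>) (\<bar>a - d\<bar> + \<bar>b - c\<bar>)"
  defines "h \<equiv> (D + 3) div 4"
  shows "(a + h \<le> b \<and> a + h \<le> c \<and> a + h \<le> d) \<or> (b + h \<le> a \<and> b + h \<le> c \<and> b + h \<le> d) \<or>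
     (c + h \<le> a \<and> c + h \<le> b \<and> c + h \<le> d) \<or> (d + h \<le> a \<and> d + h \<le> b \<and> d + h \<le> c) \<or>
     (b + h \<le> a \<and> c + h \<le> a \<and> d + h \<le> a) \<or> (a + h \<le> b \<and> c + h \<le> b \<and> d + h \<le> b) \<or>
     (a + h \<le> c \<and> b + h \<le> c \<and> d + h \<le> c) \<or> (a + h \<le> d \<and> b + h \<le> d \<and> c + h \<le> d) \<or>
     (a + h \<le> c \<and> a + h \<le> d \<and> b + h \<le> c \<and> b + h \<le> d) \<or>
     (c + h \<le> a \<and> c + h \<le> b \<and> d + h \<le> a \<and> d + h \<le> b)"
proof -
  \<comment> \<open>This is rounding up of \<open>D / 4\<close>.\<close>
  have "4 * h \<le> D + 3" "D \<le> 4 * h" unfolding h_def by linarith+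
  then show ?thesis
    unfolding D_def by (smt (verit))
qed

context innovations
begin

text \<open>Everything that the covariance estimate needs to know about a factor: a fourth moment bound
and geometric forgetting of the past. The frequency enters only through the factor \<open>w\<close> of the second
bound, so that products of several factors remain linear in \<open>w\<close>.\<close>

definition geometric_coupling ::
    "((nat \<Rightarrow> real) \<Rightarrow> complex) \<Rightarrow> int \<Rightarrow> real \<Rightarrow> real \<Rightarrow> real \<Rightarrow> bool" where
  "geometric_coupling \<phi> k B w \<theta> \<longleftrightarrow> \<phi> \<in> borel_measurable seq_space \<and>
     moment_le M 4 (\<lambda>\<omega>. \<phi> (history eps k \<omega>)) B \<and>
     (\<forall>s\<le>k. moment_le M 4 (\<lambda>\<omega>. \<phi> (history eps k \<omega>) - \<phi> (refreshed_history s k \<omega>))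
        (B * w * \<theta> ^ nat (k - s)))"

text \<open>Constant factors allow products of two factors to be treated as products of four.\<close>

lemma geometric_coupling_one:
  assumes "1 \<le> B" "0 < w" "0 < \<theta>"
  shows "geometric_coupling (\<lambda>_. 1) k B w \<theta>"
  using assms by (auto simp: geometric_coupling_def intro!: moment_le_const)

lemma geometric_coupling_cnj:
  assumes "geometric_coupling \<phi> k B w \<theta>"
  shows "geometric_coupling (\<lambda>x. cnj (\<phi> x)) k B w \<theta>"
proof -
  have [measurable]: "cnj \<in> borel_measurable borel"
    by (intro borel_measurable_continuous_onI continuous_intros)
  show ?thesis
    using assms by (auto simp: geometric_coupling_def moment_le_def simp flip: complex_cnj_diff)
qed

lemma geometric_coupling_mono:
  assumes "geometric_coupling \<phi> k B w \<theta>" "w \<le> w'" "0 < B" "0 \<le> \<theta>"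
  shows "geometric_coupling \<phi> k B w' \<theta>"
  unfolding geometric_coupling_def
proof (intro conjI allI impI)
  show "\<phi> \<in> borel_measurable seq_space" "moment_le M 4 (\<lambda>\<omega>. \<phi> (history eps k \<omega>)) B"
    using assms by (auto simp: geometric_coupling_def)
  fix s assume "s \<le> k"
  then have *: "moment_le M 4 (\<lambda>\<omega>. \<phi> (history eps k \<omega>) - \<phi> (refreshed_history s k \<omega>)) (B * w * \<theta> ^ nat (k - s))"
    using assms by (auto simp: geometric_coupling_def)
  show "moment_le M 4 (\<lambda>\<omega>. \<phi> (history eps k \<omega>) - \<phi> (refreshed_history s k \<omega>)) (B * w' * \<theta> ^ nat (k - s))"
    using * by (rule moment_le_mono) (use assms moment_le_measurable[OF *] in \<open>auto intro!: mult_right_mono mult_left_mono\<close>)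
qed

lemma moment_le_prod4:
  fixes F :: "nat \<Rightarrow> 'a \<Rightarrow> complex"
  assumes "\<And>i. i < 4 \<Longrightarrow> moment_le M 4 (F i) (A i)"
  shows "moment_le M 1 (\<lambda>\<omega>. \<Prod>i<4. F i \<omega>) (\<Prod>i<4. A i)"
proof -
  have "moment_le M (2 * 1) (\<lambda>\<omega>. F i \<omega> * F j \<omega>) (A i * A j)" if "i < 4" "j < 4" for i j
    using that assms by (intro moment_le_mult) auto
  from moment_le_mult[OF this[of 0 1] this[of 2 3]] show ?thesis
    by (simp add: eval_nat_numeral lessThan_Suc mult_ac)
qed

lemma prod4_diff:
  fixes a b :: "nat \<Rightarrow> complex"
  shows "(\<Prod>i<4. a i) - (\<Prod>i<4. b i) =
    (\<Sum>j<4. \<Prod>i<4. if i < j then b i else if i = j then a i - b i else a i)"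
  by (simp add: eval_nat_numeral lessThan_Suc algebra_simps)

text \<open>In the factors later than the cut, the innovations up to the cut are refreshed. The
resulting product has factors depending on disjoint sets of innovations, hence its mean factorises, and
the error is a telescoping sum with one coupling difference in each term.\<close>

lemma cut_decoupling:
  fixes t :: "nat \<Rightarrow> int" and \<phi> :: "nat \<Rightarrow> (nat \<Rightarrow> real) \<Rightarrow> complex"
  assumes coupling: "\<And>i. i < 4 \<Longrightarrow> geometric_coupling (\<phi> i) (t i) B w \<theta>"
    and B: "1 \<le> B" and w: "0 < w" and \<theta>: "0 < \<theta>" "\<theta> \<le> 1"
    and A: "A \<subseteq> {..<4}" "\<And>i. i \<in> A \<Longrightarrow> t i \<le> s" "\<And>i. i < 4 \<Longrightarrow> i \<notin> A \<Longrightarrow> s + int h \<le> t i"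
  defines "Y \<equiv> \<lambda>i \<omega>. \<phi> i (history eps (t i) \<omega>)"
  shows "norm ((\<integral>\<omega>. (\<Prod>i<4. Y i \<omega>) \<partial>M) -
      (\<integral>\<omega>. (\<Prod>i\<in>A. Y i \<omega>) \<partial>M) * (\<integral>\<omega>. (\<Prod>i\<in>{..<4}-A. Y i \<omega>) \<partial>M)) \<le> 4 * (B ^ 4 * w * \<theta> ^ h)"
proof -
  define Y' where "Y' i \<omega> = \<phi> i (refreshed_history s (t i) \<omega>)" for i \<omega>
  define Z where "Z i = (if i \<in> A then Y i else Y' i)" for i
  have \<phi>[measurable]: "\<phi> i \<in> borel_measurable seq_space" if "i < 4" for i
    using coupling[OF that] by (simp add: geometric_coupling_def)
  have Y: "moment_le M 4 (Y i) B" if "i < 4" for i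
    using coupling[OF that] by (simp add: geometric_coupling_def Y_def)
  have Y': "moment_le M 4 (Y' i) B" if "i < 4" for i
    using Y[OF that] \<phi>[OF that] unfolding Y_def Y'_def by (rule moment_le_refreshed_history)
  have Z: "moment_le M 4 (Z i) B" if "i < 4" for i
    using Y[OF that] Y'[OF that] by (simp add: Z_def)
  have diff: "moment_le M 4 (\<lambda>\<omega>. Y i \<omega> - Z i \<omega>) (B * w * \<theta> ^ h)" if "i < 4" for i
  proof (cases "i \<in> A")
    case True
    then show ?thesis using B w \<theta> by (auto simp: Z_def intro!: moment_le_const)
  next
    case False
    with A that have i: "s \<le> t i" "h \<le> nat (t i - s)" by force+
    have "moment_le M 4 (\<lambda>\<omega>. Y i \<omega> - Y' i \<omega>) (B * w * \<theta> ^ nat (t i - s))"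
      using coupling[OF that] i(1) by (simp add: geometric_coupling_def Y_def Y'_def)
    then have "moment_le M 4 (\<lambda>\<omega>. Y i \<omega> - Y' i \<omega>) (B * w * \<theta> ^ h)"
      by (rule moment_le_mono)
        (use B w \<theta> i(2) moment_le_measurable[OF Y] moment_le_measurable[OF Y'] that
          in \<open>auto intro!: mult_left_mono power_decreasing\<close>)
    then show ?thesis using False by (simp add: Z_def)
  qed
  have int_Y: "integrable M (\<lambda>\<omega>. \<Prod>i<4. Y i \<omega>)" and int_Z: "integrable M (\<lambda>\<omega>. \<Prod>i<4. Z i \<omega>)"
    using moment_le_prod4[of Y "\<lambda>_. B"] moment_le_prod4[of Z "\<lambda>_. B"] Y Z
    by (auto intro: moment_le_1_integral)
  let ?term = "\<lambda>j \<omega>. \<Prod>i<4. if i < j then Z i \<omega> else if i = j then Y i \<omega> - Z i \<omega> else Y i \<omega>"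
  have "moment_le M 1 (?term j) (\<Prod>i<4. if i = j then B * w * \<theta> ^ h else B)" if "j < 4" for j
  proof (rule moment_le_prod4)
    fix i :: nat assume "i < 4"
    then show "moment_le M 4 (\<lambda>\<omega>. if i < j then Z i \<omega> else if i = j then Y i \<omega> - Z i \<omega> else Y i \<omega>)
        (if i = j then B * w * \<theta> ^ h else B)"
      using Y Z diff by (cases i j rule: linorder_cases) auto
  qed
  moreover have "(\<Prod>i<4::nat. if i = j then B * w * \<theta> ^ h else B) = B ^ 4 * w * \<theta> ^ h" if "j < 4" for j :: nat
    using that by (auto simp: eval_nat_numeral lessThan_Suc less_Suc_eq)
  ultimately have tm: "moment_le M 1 (?term j) (B ^ 4 * w * \<theta> ^ h)" if "j < 4" for j
    using that by simp
  have "norm ((\<integral>\<omega>. (\<Prod>i<4. Y i \<omega>) \<partial>M) - (\<integral>\<omega>. (\<Prod>i<4. Z i \<omega>) \<partial>M)) = norm (\<Sum>j<4. \<integral>\<omega>. ?term j \<omega> \<partial>M)"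
    using int_Y int_Z moment_le_1_integral(1)[OF tm]
    by (subst Bochner_Integration.integral_diff[symmetric]) (auto simp: prod4_diff)
  also have "\<dots> \<le> (\<Sum>j<4::nat. B ^ 4 * w * \<theta> ^ h)"
    using moment_le_1_integral(2)[OF tm] by (intro sum_norm_le) auto
  finally have close: "norm ((\<integral>\<omega>. (\<Prod>i<4. Y i \<omega>) \<partial>M) - (\<integral>\<omega>. (\<Prod>i<4. Z i \<omega>) \<partial>M))
      \<le> 4 * (B ^ 4 * w * \<theta> ^ h)" by simp
  have int_sub: "integrable M (\<lambda>\<omega>. \<Prod>i\<in>C. F i \<omega>)"
    if "C \<subseteq> {..<4}" "\<And>i. i < 4 \<Longrightarrow> moment_le M 4 (F i) B" for C and F :: "nat \<Rightarrow> 'a \<Rightarrow> complex"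
  proof -
    have "moment_le M 1 (\<lambda>\<omega>. \<Prod>i<4. if i \<in> C then F i \<omega> else 1) (\<Prod>i<4::nat. B)"
    proof (rule moment_le_prod4)
      fix i :: nat assume "i < 4"
      then show "moment_le M 4 (\<lambda>\<omega>. if i \<in> C then F i \<omega> else 1) B"
        using that(2) B by (cases "i \<in> C") (auto intro!: moment_le_const)
    qed
    moreover have "(\<Prod>i<4. if i \<in> C then F i \<omega> else 1) = (\<Prod>i\<in>C. F i \<omega>)" for \<omega>
      using that(1) by (simp add: prod.If_cases Int_absorb1)
    ultimately show ?thesis by (auto intro: moment_le_1_integral)
  qed
  \<comment> \<open>The early factors are read off the sequence of innovations up to \<open>s\<close>, the late ones off the
    sequence indexed by all times, in which the past up to \<open>s\<close> is refreshed.\<close>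
  define u where "u x = (\<Prod>i\<in>A. \<phi> i (\<lambda>m. x (nat (s - t i) + m)))" for x :: "nat \<Rightarrow> real"
  define v where "v x = (\<Prod>i\<in>{..<4}-A. \<phi> i (\<lambda>m. x (t i - int m)))" for x :: "int \<Rightarrow> real"
  let ?\<sigma> = "\<lambda>i. Inl (s - int i) :: int + int"
  let ?\<tau> = "\<lambda>n. if n \<le> s then Inr n else Inl n :: int + int"
  have u[measurable]: "u \<in> borel_measurable seq_space"
    unfolding u_def using A(1)
    by (intro borel_measurable_prod measurable_compose[OF measurable_seq_space \<phi>]) auto
  have v[measurable]: "v \<in> borel_measurable seq_space"
    unfolding v_def
    by (intro borel_measurable_prod measurable_compose[OF measurable_seq_space \<phi>]) auto
  have u_eq: "u (select ?\<sigma> \<omega>) = (\<Prod>i\<in>A. Y i \<omega>)" for \<omega>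
    unfolding u_def Y_def history_select
    by (intro prod.cong refl arg_cong[where f = "\<phi> _"]) (use A(2) in \<open>force simp: select_def\<close>)
  have v_eq: "v (select ?\<tau> \<omega>) = (\<Prod>i\<in>{..<4}-A. Y' i \<omega>)" for \<omega>
    unfolding v_def Y'_def refreshed_history_def
    by (intro prod.cong refl arg_cong[where f = "\<phi> _"]) (auto simp: select_def)
  have v_eq': "v (select Inl \<omega>) = (\<Prod>i\<in>{..<4}-A. Y i \<omega>)" for \<omega>
    unfolding v_def Y_def history_select
    by (intro prod.cong refl arg_cong[where f = "\<phi> _"]) (auto simp: select_def)
  have split: "(\<Prod>i<4. Z i \<omega>) = (\<Prod>i\<in>A. Y i \<omega>) * (\<Prod>i\<in>{..<4}-A. Y' i \<omega>)" for \<omega>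
    by (subst prod.subset_diff[OF A(1)]) (auto simp: Z_def mult.commute intro!: arg_cong2[where f = "(*)"] prod.cong)
  have "(\<integral>\<omega>. (\<Prod>i<4. Z i \<omega>) \<partial>M) = (\<integral>\<omega>. u (select ?\<sigma> \<omega>) * v (select ?\<tau> \<omega>) \<partial>M)"
    by (simp add: split u_eq v_eq)
  also have "\<dots> = (\<integral>\<omega>. u (select ?\<sigma> \<omega>) \<partial>M) * (\<integral>\<omega>. v (select ?\<tau> \<omega>) \<partial>M)"
  proof (rule indep_select)
    show "range ?\<sigma> \<inter> range ?\<tau> = {}" by (auto split: if_splits)
    show "integrable M (\<lambda>\<omega>. u (select ?\<sigma> \<omega>))" "integrable M (\<lambda>\<omega>. v (select ?\<tau> \<omega>))"
      using A(1) Y Y' by (auto simp: u_eq v_eq intro!: int_sub)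
  qed auto
  also have "(\<integral>\<omega>. v (select ?\<tau> \<omega>) \<partial>M) = (\<integral>\<omega>. v (select Inl \<omega>) \<partial>M)"
    by (rule integral_select) (auto simp: inj_def)
  finally show ?thesis
    using close by (simp add: u_eq v_eq')
qed

text \<open>If a cut isolates a centred factor, the product of means in the decoupled expression vanishes.\<close>

lemma isolated_factor_bound:
  fixes t :: "nat \<Rightarrow> int" and \<phi> :: "nat \<Rightarrow> (nat \<Rightarrow> real) \<Rightarrow> complex"
  assumes coupling: "\<And>i. i < 4 \<Longrightarrow> geometric_coupling (\<phi> i) (t i) B w \<theta>"
    and B: "1 \<le> B" and w: "0 < w" and \<theta>: "0 < \<theta>" "\<theta> \<le> 1"
    and i: "i < 4" "(\<integral>\<omega>. \<phi> i (history eps (t i) \<omega>) \<partial>M) = 0"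
    and cut: "(\<forall>j<4. j \<noteq> i \<longrightarrow> t i + int h \<le> t j) \<or> (\<forall>j<4. j \<noteq> i \<longrightarrow> t j + int h \<le> t i)"
  shows "norm (\<integral>\<omega>. (\<Prod>j<4. \<phi> j (history eps (t j) \<omega>)) \<partial>M) \<le> 4 * (B ^ 4 * w * \<theta> ^ h)"
  using cut
proof
  assume "\<forall>j<4. j \<noteq> i \<longrightarrow> t i + int h \<le> t j"
  then show ?thesis
    using cut_decoupling[of \<phi> t B w \<theta> "{i}" "t i" h] assms by simp
next
  assume "\<forall>j<4. j \<noteq> i \<longrightarrow> t j + int h \<le> t i"
  moreover have "{..<4} - ({..<4} - {i}) = {i}" using i by auto
  ultimately show ?thesis
    using cut_decoupling[of \<phi> t B w \<theta> "{..<4} - {i}" "t i - int h" h] assms by force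
qed

text \<open>With \<open>\<theta> = q ^ 4\<close>, a cut of width at least \<open>D / 4\<close> yields the rate \<open>q\<close> per unit of \<open>D\<close>.
If the cut isolates a point, both the mean of the full product and the mean of the pair containing
that point are small by themselves.\<close>

lemma covariance_bound:
  fixes t :: "nat \<Rightarrow> int" and \<phi> :: "nat \<Rightarrow> (nat \<Rightarrow> real) \<Rightarrow> complex"
  assumes coupling: "\<And>i. i < 4 \<Longrightarrow> geometric_coupling (\<phi> i) (t i) B w (q ^ 4)"
    and B: "1 \<le> B" and w: "0 < w" and q: "0 < q" "q \<le> 1"
    and centred: "\<And>i. i < 4 \<Longrightarrow> (\<integral>\<omega>. \<phi> i (history eps (t i) \<omega>) \<partial>M) = 0"
  defines "Y \<equiv> \<lambda>i \<omega>. \<phi> i (history eps (t i) \<omega>)"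
  shows "norm ((\<integral>\<omega>. Y 0 \<omega> * Y 1 \<omega> * (Y 2 \<omega> * Y 3 \<omega>) \<partial>M) -
      (\<integral>\<omega>. Y 0 \<omega> * Y 1 \<omega> \<partial>M) * (\<integral>\<omega>. Y 2 \<omega> * Y 3 \<omega> \<partial>M))
    \<le> 8 * B ^ 6 * w * (q ^ nat \<bar>t 0 - t 2\<bar> * q ^ nat \<bar>t 1 - t 3\<bar> +
                      q ^ nat \<bar>t 0 - t 3\<bar> * q ^ nat \<bar>t 1 - t 2\<bar>)"
    (is "?cov \<le> _")
proof -
  define D where "D = min (\<bar>t 0 - t 2\<bar> + \<bar>t 1 - t 3\<bar>) (\<bar>t 0 - t 3\<bar> + \<bar>t 1 - t 2\<bar>)"
  define h where "h = nat ((D + 3) div 4)"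
  let ?\<theta> = "q ^ 4"
  have \<theta>: "0 < ?\<theta>" "?\<theta> \<le> 1" using q by (auto intro: power_le_one)
  have "0 \<le> D" by (simp add: D_def)
  then have h: "int h = (D + 3) div 4" by (simp add: h_def)
  have four: "(\<forall>i<4. P i) \<longleftrightarrow> P 0 \<and> P 1 \<and> P 2 \<and> P 3" for P :: "nat \<Rightarrow> bool"
    by (auto simp: eval_nat_numeral less_Suc_eq)
  have fourI: "i = 0 \<or> i = 1 \<or> i = 2 \<or> i = 3" if "i < 4" for i :: nat
    using that by auto
  have four_set: "{..<4::nat} = {0, 1, 2, 3}" by auto
  have Y: "moment_le M 4 (Y i) B" if "i < 4" for i
    using coupling[OF that] by (simp add: geometric_coupling_def Y_def)
  have pair: "moment_le M 1 (\<lambda>\<omega>. Y i \<omega> * Y j \<omega>) (B\<^sup>2)" if "i < 4" "j < 4" for i j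
    using moment_le_halve[of 1] moment_le_mult[of M 2 "Y i" B "Y j" B] Y that
    by (simp add: power2_eq_square)
  have prod: "(\<Prod>i<4. F i \<omega>) = F 0 \<omega> * F 1 \<omega> * (F 2 \<omega> * F 3 \<omega>)" for F :: "nat \<Rightarrow> 'a \<Rightarrow> complex" and \<omega>
    by (simp add: four_set mult_ac)
  have weaken: "4 * (B ^ 4 * w * ?\<theta> ^ h) \<le> 8 * B ^ 6 * w * ?\<theta> ^ h"
  proof -
    have "4 * B ^ 4 \<le> 8 * B ^ 6"
      using B power_increasing[of 4 6 B] zero_le_power[of B 6] by linarith
    then have "4 * B ^ 4 * (w * ?\<theta> ^ h) \<le> 8 * B ^ 6 * (w * ?\<theta> ^ h)"
      using w \<theta> by (intro mult_right_mono) auto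
    then show ?thesis by (simp add: mult_ac)
  qed
  have key: "?cov \<le> 8 * B ^ 6 * w * ?\<theta> ^ h"
  proof -
    consider
        (isolated) i where "i < 4"
          "(\<forall>j<4. j \<noteq> i \<longrightarrow> t i + int h \<le> t j) \<or> (\<forall>j<4. j \<noteq> i \<longrightarrow> t j + int h \<le> t i)"
      | (first) "\<forall>i\<in>{0,1}. \<forall>j\<in>{2,3}. t i + int h \<le> t j"
      | (second) "\<forall>i\<in>{2,3}. \<forall>j\<in>{0,1}. t i + int h \<le> t j"
    proof -
      have "(\<exists>i<4. (\<forall>j<4. j \<noteq> i \<longrightarrow> t i + int h \<le> t j) \<or> (\<forall>j<4. j \<noteq> i \<longrightarrow> t j + int h \<le> t i)) \<or>
          (\<forall>i\<in>{0,1}. \<forall>j\<in>{2,3}. t i + int h \<le> t j) \<or> (\<forall>i\<in>{2,3}. \<forall>j\<in>{0,1}. t i + int h \<le> t j)"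
        using cut_exists[where a = "t 0" and b = "t 1" and c = "t 2" and d = "t 3", folded D_def, folded h]
        apply (elim disjE)
        apply (rule disjI1, rule exI[of _ 0], simp add: four; fail)
        apply (rule disjI1, rule exI[of _ 1], simp add: four; fail)
        apply (rule disjI1, rule exI[of _ 2], simp add: four; fail)
        apply (rule disjI1, rule exI[of _ 3], simp add: four; fail)
        apply (rule disjI1, rule exI[of _ 0], simp add: four; fail)
        apply (rule disjI1, rule exI[of _ 1], simp add: four; fail)
        apply (rule disjI1, rule exI[of _ 2], simp add: four; fail)
        apply (rule disjI1, rule exI[of _ 3], simp add: four; fail)
        by simp_all
      then show thesis using isolated first second by blast
    qed
    then show ?thesis
    proof cases
      case isolated
      let ?N = "4 * (B ^ 4 * w * ?\<theta> ^ h)"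
      have all: "norm (\<integral>\<omega>. Y 0 \<omega> * Y 1 \<omega> * (Y 2 \<omega> * Y 3 \<omega>) \<partial>M) \<le> ?N"
        using isolated_factor_bound[OF coupling B w \<theta> isolated(1) centred isolated(2)] isolated(1)
        unfolding prod[of Y, symmetric] unfolding Y_def by simp
      have sub: "norm (\<integral>\<omega>. (\<Prod>j<4. if j \<in> J then Y j \<omega> else 1) \<partial>M) \<le> ?N" if "i \<in> J" for J
      proof -
        have "norm (\<integral>\<omega>. (\<Prod>j<4. (if j \<in> J then \<phi> j else (\<lambda>_. 1)) (history eps (t j) \<omega>)) \<partial>M) \<le> ?N"
          by (rule isolated_factor_bound[OF _ B w \<theta> isolated(1) _ isolated(2)])
            (use coupling geometric_coupling_one[OF B w \<theta>(1)] centred isolated(1) that in auto)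
        moreover have "(if j \<in> J then \<phi> j else (\<lambda>_. 1)) (history eps (t j) \<omega>) = (if j \<in> J then Y j \<omega> else 1)" for j \<omega>
          by (simp add: Y_def)
        ultimately show ?thesis by simp
      qed
      have "norm ((\<integral>\<omega>. Y 0 \<omega> * Y 1 \<omega> \<partial>M) * (\<integral>\<omega>. Y 2 \<omega> * Y 3 \<omega> \<partial>M)) \<le> ?N * B\<^sup>2"
      proof (cases "i \<in> {0, 1}")
        case True
        have "norm (\<integral>\<omega>. Y 0 \<omega> * Y 1 \<omega> \<partial>M) \<le> ?N"
          using sub[OF True] by (simp add: four_set)
        moreover have "norm (\<integral>\<omega>. Y 2 \<omega> * Y 3 \<omega> \<partial>M) \<le> B\<^sup>2"
          by (intro moment_le_1_integral pair) auto
        ultimately show ?thesis using B w \<theta> by (auto simp: norm_mult intro!: mult_mono)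
      next
        case False
        then have "i \<in> {2, 3}" using fourI[OF isolated(1)] by auto
        from sub[OF this] have "norm (\<integral>\<omega>. Y 2 \<omega> * Y 3 \<omega> \<partial>M) \<le> ?N"
          by (simp add: four_set)
        moreover have "norm (\<integral>\<omega>. Y 0 \<omega> * Y 1 \<omega> \<partial>M) \<le> B\<^sup>2"
          by (intro moment_le_1_integral pair) auto
        ultimately have "norm (\<integral>\<omega>. Y 0 \<omega> * Y 1 \<omega> \<partial>M) * norm (\<integral>\<omega>. Y 2 \<omega> * Y 3 \<omega> \<partial>M) \<le> B\<^sup>2 * ?N"
          using B w \<theta> by (intro mult_mono) auto
        then show ?thesis by (simp add: norm_mult mult.commute)
      qed
      then have "?cov \<le> ?N + ?N * B\<^sup>2"
        using all norm_triangle_ineq4[of "\<integral>\<omega>. Y 0 \<omega> * Y 1 \<omega> * (Y 2 \<omega> * Y 3 \<omega>) \<partial>M"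
            "(\<integral>\<omega>. Y 0 \<omega> * Y 1 \<omega> \<partial>M) * (\<integral>\<omega>. Y 2 \<omega> * Y 3 \<omega> \<partial>M)"] by linarith
      also have "?N * 1 \<le> ?N * B\<^sup>2"
        using B w \<theta> by (intro mult_left_mono one_le_power) auto
      then have "?N + ?N * B\<^sup>2 \<le> 8 * B ^ 6 * w * ?\<theta> ^ h"
        by (simp add: eval_nat_numeral mult_ac)
      finally show ?thesis .
    next
      case first
      have compl: "{..<4} - {0, 1} = ({2, 3} :: nat set)" by (auto simp: four_set)
      have "norm ((\<integral>\<omega>. (\<Prod>i<4. Y i \<omega>) \<partial>M) -
          (\<integral>\<omega>. (\<Prod>i\<in>{0, 1}. Y i \<omega>) \<partial>M) * (\<integral>\<omega>. (\<Prod>i\<in>{..<4}-{0, 1}. Y i \<omega>) \<partial>M)) \<le> 4 * (B ^ 4 * w * ?\<theta> ^ h)"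
        unfolding Y_def
      proof (rule cut_decoupling[OF coupling B w \<theta>, where s = "max (t 0) (t 1)"])
        fix i :: nat assume "i < 4" "i \<notin> {0, 1}"
        then have "i \<in> {2, 3}" using compl by blast
        then show "max (t 0) (t 1) + int h \<le> t i" using first by auto
      qed auto
      then have "?cov \<le> 4 * (B ^ 4 * w * ?\<theta> ^ h)"
        unfolding compl by (simp add: prod mult.commute)
      also have "\<dots> \<le> 8 * B ^ 6 * w * ?\<theta> ^ h"
        by (rule weaken)
      finally show ?thesis .
    next
      case second
      have compl: "{..<4} - {2, 3} = ({0, 1} :: nat set)" by (auto simp: four_set)
      have "norm ((\<integral>\<omega>. (\<Prod>i<4. Y i \<omega>) \<partial>M) -
          (\<integral>\<omega>. (\<Prod>i\<in>{2, 3}. Y i \<omega>) \<partial>M) * (\<integral>\<omega>. (\<Prod>i\<in>{..<4}-{2, 3}. Y i \<omega>) \<partial>M)) \<le> 4 * (B ^ 4 * w * ?\<theta> ^ h)"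
        unfolding Y_def
      proof (rule cut_decoupling[OF coupling B w \<theta>, where s = "max (t 2) (t 3)"])
        fix i :: nat assume "i < 4" "i \<notin> {2, 3}"
        then have "i \<in> {0, 1}" using compl by blast
        then show "max (t 2) (t 3) + int h \<le> t i" using second by auto
      qed auto
      then have "?cov \<le> 4 * (B ^ 4 * w * ?\<theta> ^ h)"
        unfolding compl by (simp add: prod mult.commute)
      also have "\<dots> \<le> 8 * B ^ 6 * w * ?\<theta> ^ h"
        by (rule weaken)
      finally show ?thesis .
    qed
  qed
  have "?\<theta> ^ h = q ^ (4 * h)" by (simp add: power_mult)
  also have "\<dots> \<le> q ^ nat D"
    using q h by (intro power_decreasing) auto
  also have "\<dots> \<le> q ^ nat (\<bar>t 0 - t 2\<bar> + \<bar>t 1 - t 3\<bar>) + q ^ nat (\<bar>t 0 - t 3\<bar> + \<bar>t 1 - t 2\<bar>)"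
    using q by (auto simp: D_def min_def)
  also have "\<dots> = q ^ nat \<bar>t 0 - t 2\<bar> * q ^ nat \<bar>t 1 - t 3\<bar> + q ^ nat \<bar>t 0 - t 3\<bar> * q ^ nat \<bar>t 1 - t 2\<bar>"
    by (simp add: nat_add_distrib power_add)
  finally have "8 * B ^ 6 * w * ?\<theta> ^ h \<le> 8 * B ^ 6 * w * \<dots>"
    using B w by (intro mult_left_mono) auto
  with key show ?thesis by linarith
qed

end

section \<open>Coupling of the centred characters\<close>

text \<open>Interpolation between the Lipschitz bound and the trivial bound \<open>2\<close>.\<close>

lemma norm_iexp_diff_le:
  fixes u v :: real
  assumes "0 < \<eta>" "\<eta> \<le> 1"
  shows "norm (iexp u - iexp v) \<le> 2 * \<bar>u - v\<bar> powr \<eta>"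
proof (cases "\<bar>u - v\<bar> \<le> 1")
  case True
  have "iexp u - iexp v = iexp v * (iexp (u - v) - 1)"
    by (simp add: algebra_simps flip: exp_add)
  then have "norm (iexp u - iexp v) = norm (iexp (u - v) - 1)"
    by (simp add: norm_mult)
  also have "\<dots> \<le> \<bar>u - v\<bar>" using iexp_approx1[of "u - v" 0] by simp
  also have "\<dots> \<le> \<bar>u - v\<bar> powr \<eta>"
    using powr_mono'[of \<eta> 1 "\<bar>u - v\<bar>"] assms True by simp
  finally show ?thesis using powr_ge_zero[of "\<bar>u - v\<bar>" \<eta>] by linarith
next
  case False
  have "norm (iexp u - iexp v) \<le> 2 * 1"
    using norm_triangle_ineq4[of "iexp u" "iexp v"] by simp
  also have "1 \<le> \<bar>u - v\<bar> powr \<eta>"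
    using False assms by (intro ge_one_powr_ge_zero) auto
  finally show ?thesis by simp
qed

text \<open>The hypothesis on the derivative bounds it on the whole segment by its values at the end points,
whose moments are known when these are values of the process.\<close>

lemma diff_le_derivative_bound:
  fixes L L' :: "real \<Rightarrow> real"
  assumes deriv: "\<And>x. (L has_real_derivative L' x) (at x)"
    and bound: "\<And>a b t. a \<le> t \<Longrightarrow> t \<le> b \<Longrightarrow> \<bar>L' t\<bar> \<le> C * (\<bar>L' a\<bar> + \<bar>L' b\<bar> + 1)"
  shows "\<bar>L a - L b\<bar> \<le> \<bar>C\<bar> * ((\<bar>L' a\<bar> + \<bar>L' b\<bar> + 1) * \<bar>a - b\<bar>)"
proof -
  have *: "\<bar>L b - L a\<bar> \<le> \<bar>C\<bar> * ((\<bar>L' a\<bar> + \<bar>L' b\<bar> + 1) * \<bar>b - a\<bar>)" if "a < b" for a b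
  proof -
    note lt = that
    obtain z where z: "a < z" "z < b" "L b - L a = (b - a) * L' z"
      using MVT2[OF lt, of L L'] deriv by blast
    have "\<bar>L' z\<bar> \<le> C * (\<bar>L' a\<bar> + \<bar>L' b\<bar> + 1)" using z by (intro bound) auto
    also have "\<dots> \<le> \<bar>C\<bar> * (\<bar>L' a\<bar> + \<bar>L' b\<bar> + 1)" by (intro mult_right_mono) auto
    finally have "\<bar>L' z\<bar> * \<bar>b - a\<bar> \<le> \<bar>C\<bar> * (\<bar>L' a\<bar> + \<bar>L' b\<bar> + 1) * \<bar>b - a\<bar>"
      by (intro mult_right_mono) auto
    then show ?thesis by (simp add: z(3) abs_mult mult_ac)
  qed
  show ?thesis
    using *[of a b] *[of b a] by (cases a b rule: linorder_cases) (auto simp: abs_minus_commute add_ac)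
qed

text \<open>The derivative is a pointwise limit of difference quotients.\<close>

lemma derivative_measurable:
  fixes L L' :: "real \<Rightarrow> real"
  assumes deriv: "\<And>x. (L has_real_derivative L' x) (at x)"
  shows "L \<in> borel_measurable borel" "L' \<in> borel_measurable borel"
proof -
  have "continuous_on UNIV L"
    using deriv by (meson DERIV_isCont continuous_at_imp_continuous_on)
  then show L[measurable]: "L \<in> borel_measurable borel" by (rule borel_measurable_continuous_onI)
  show "L' \<in> borel_measurable borel"
  proof (rule borel_measurable_LIMSEQ_real)
    show "(\<lambda>n. (L (x + inverse (real (Suc n))) - L x) / inverse (real (Suc n))) \<longlonglongrightarrow> L' x" for x
      using deriv[of x, unfolded DERIV_def]
      by (rule filterlim_compose)
        (auto simp: filterlim_at simp del: of_nat_Suc intro!: LIMSEQ_inverse_real_of_nat)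
  qed measurable
qed

text \<open>Normalised to \<open>u\<close>, the claim follows from \<open>u powr \<eta> \<le> max 1 u\<close>; the factor \<open>2\<close> pays for the maximum.\<close>

lemma (in prob_space) moment_le_powr:
  fixes Y :: "'a \<Rightarrow> real"
  assumes Y: "moment_le M 8 Y A" and \<eta>: "0 < \<eta>" "\<eta> \<le> 1"
  shows "moment_le M 8 (\<lambda>\<omega>. \<bar>Y \<omega>\<bar> powr \<eta>) (2 * A powr \<eta>)"
proof (rule moment_le_combine[OF Y moment_le_const[of "1::real" 1 8]])
  note [measurable] = moment_le_measurable[OF Y]
  have A: "0 < A" using Y by (rule moment_le_pos)
  then show "0 < 2 * A powr \<eta>" by simp
  show "(\<lambda>\<omega>. \<bar>Y \<omega>\<bar> powr \<eta>) \<in> borel_measurable M" by measurable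
  fix \<omega>
  define u where "u = \<bar>Y \<omega>\<bar> / A"
  have u: "0 \<le> u" using A by (simp add: u_def)
  have "u powr \<eta> \<le> max 1 u"
  proof (cases "u \<le> 1")
    case True
    then show ?thesis using powr_mono2[of \<eta> u 1] u \<eta> by simp
  next
    case False
    then show ?thesis using powr_mono[of \<eta> 1 u] \<eta> by simp
  qed
  then have "(u powr \<eta> / 2) ^ 8 \<le> (max 1 u / 2) ^ 8"
    by (intro power_mono divide_right_mono) auto
  also have "\<dots> \<le> (1 + u ^ 8) / 256"
    using u by (cases "u \<le> 1") (auto simp: power_divide max_def)
  also have "\<dots> \<le> 1/2 * u ^ 8 + 1/2" using u by simp
  finally show "(norm (\<bar>Y \<omega>\<bar> powr \<eta>) / (2 * A powr \<eta>)) ^ 8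
      \<le> 1/2 * (norm (Y \<omega>) / A) ^ 8 + 1/2 * (norm (1::real) / 1) ^ 8"
    using A by (simp add: u_def powr_divide mult.commute)
qed auto

context innovations
begin

text \<open>The difference of \<open>L(X) exp(ixX)\<close> and its refreshed version is split into
\<open>(L(X) - L(X')) exp(ixX)\<close> and \<open>L(X') (exp(ixX) - exp(ixX'))\<close>; eighth moments and Hoelder's
inequality give fourth moments of both products. The dependence measure may be infinite at small lags,
whence the threshold \<open>m0\<close>; below it the trivial bound is absorbed into \<open>B\<close>.\<close>

lemma oscillation_coupling:
  fixes G :: "(nat \<Rightarrow> real) \<Rightarrow> real" and L L' :: "real \<Rightarrow> real" and k :: int
  assumes G[measurable]: "G \<in> borel_measurable seq_space"
    and deriv: "\<And>x. (L has_real_derivative L' x) (at x)"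
    and bound: "\<And>a b t. a \<le> t \<Longrightarrow> t \<le> b \<Longrightarrow> \<bar>L' t\<bar> \<le> C * (\<bar>L' a\<bar> + \<bar>L' b\<bar> + 1)"
    and \<eta>: "0 < \<eta>" "\<eta> \<le> 1" and \<rho>: "0 < \<rho>" "\<rho> < 1"
    and L_mom: "moment_le M 8 (\<lambda>\<omega>. L (G (history eps k \<omega>))) K"
    and L'_mom: "moment_le M 8 (\<lambda>\<omega>. L' (G (history eps k \<omega>))) K"
    and dep: "\<And>s. s \<le> k \<Longrightarrow> m0 \<le> nat (k - s) \<Longrightarrow>
      moment_le M 8 (\<lambda>\<omega>. G (history eps k \<omega>) - G (refreshed_history s k \<omega>)) (b * \<rho> ^ nat (k - s))"
    and B: "2 * K \<le> B" "2 * K \<le> B * (\<rho> powr \<eta>) ^ m0" "(\<bar>C\<bar> + 1) * (2 * K + 1) * b + 4 * K * (1 + b) \<le> B"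
    and b: "0 < b"
  defines "X \<equiv> \<lambda>\<omega>. G (history eps k \<omega>)"
  shows "geometric_coupling (\<lambda>z. complex_of_real (L (G z)) * iexp (x * G z) - (\<integral>\<omega>. beta L X x \<omega> \<partial>M))
           k B (1 + \<bar>x\<bar> powr \<eta>) (\<rho> powr \<eta>)"
proof -
  note [measurable] = derivative_measurable[OF deriv]
  define \<psi> where "\<psi> z = complex_of_real (L (G z)) * iexp (x * G z)" for z
  have \<psi>[measurable]: "\<psi> \<in> borel_measurable seq_space"
    unfolding \<psi>_def by measurable
  define w where "w = 1 + \<bar>x\<bar> powr \<eta>"
  have w: "1 \<le> w" by (simp add: w_def)
  let ?\<theta> = "\<rho> powr \<eta>"
  have \<theta>: "0 < ?\<theta>" "?\<theta> \<le> 1" using \<rho> \<eta> by (auto intro: powr_le1)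
  have K: "0 < K" using L_mom by (rule moment_le_pos)
  have "0 < B" using B(1) K by linarith
  have \<psi>8: "moment_le M 8 (\<lambda>\<omega>. \<psi> (history eps k \<omega>)) K"
    by (rule moment_le_mono[OF L_mom]) (auto simp: \<psi>_def norm_mult)
  have \<psi>4: "moment_le M 4 (\<lambda>\<omega>. \<psi> (history eps k \<omega>)) K"
    using moment_le_halve[of 4] \<psi>8 by simp
  have \<psi>4': "moment_le M 4 (\<lambda>\<omega>. \<psi> (refreshed_history s k \<omega>)) K" for s
    by (rule moment_le_refreshed_history[OF \<psi>4 \<psi>])
  have beta: "beta L X x \<omega> = \<psi> (history eps k \<omega>)" for \<omega>
    by (simp add: beta_def X_def \<psi>_def)
  have mean: "norm (\<integral>\<omega>. beta L X x \<omega> \<partial>M) \<le> K"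
    unfolding beta using moment_le_halve[of 1 "\<lambda>\<omega>. \<psi> (history eps k \<omega>)" K] moment_le_halve[of 2 "\<lambda>\<omega>. \<psi> (history eps k \<omega>)" K] \<psi>4
    by (intro moment_le_1_integral) simp
  have "moment_le M 4 (\<lambda>\<omega>. \<psi> (history eps k \<omega>) + - (\<integral>\<omega>. beta L X x \<omega> \<partial>M)) (K + K)"
    using mean K by (intro moment_le_add \<psi>4 moment_le_const) auto
  then have size: "moment_le M 4 (\<lambda>\<omega>. \<psi> (history eps k \<omega>) - (\<integral>\<omega>. beta L X x \<omega> \<partial>M)) B"
    by (rule moment_le_mono) (use B in auto)
  have diff: "moment_le M 4 (\<lambda>\<omega>. \<psi> (history eps k \<omega>) - \<psi> (refreshed_history s k \<omega>))
      (B * w * ?\<theta> ^ nat (k - s))" if s: "s \<le> k" for s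
  proof (cases "m0 \<le> nat (k - s)")
    case False
    have "moment_le M 4 (\<lambda>\<omega>. \<psi> (history eps k \<omega>) + (-1) * \<psi> (refreshed_history s k \<omega>)) (K + 1 * K)"
      by (intro moment_le_add \<psi>4 moment_le_cmult \<psi>4') auto
    then show ?thesis
    proof (rule moment_le_mono)
      have "K + 1 * K \<le> B * ?\<theta> ^ m0" using B by simp
      also have "\<dots> \<le> B * ?\<theta> ^ nat (k - s)"
        using False \<theta> \<open>0 < B\<close> by (intro mult_left_mono power_decreasing) auto
      also have "\<dots> = 1 * (B * ?\<theta> ^ nat (k - s))" by simp
      also have "\<dots> \<le> w * (B * ?\<theta> ^ nat (k - s))"
        using w \<theta> \<open>0 < B\<close> by (intro mult_right_mono) auto
      finally show "K + 1 * K \<le> B * w * ?\<theta> ^ nat (k - s)" by (simp add: mult_ac)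
    qed auto
  next
    case True
    define h where "h = nat (k - s)"
    define X' where "X' \<omega> = G (refreshed_history s k \<omega>)" for \<omega>
    have [measurable]: "X \<in> borel_measurable M" "X' \<in> borel_measurable M"
      unfolding X_def X'_def by measurable
    have \<Delta>: "moment_le M 8 (\<lambda>\<omega>. X \<omega> - X' \<omega>) (b * \<rho> ^ h)"
      using dep[OF s True] by (simp add: X_def X'_def h_def)
    have L_X': "moment_le M 8 (\<lambda>\<omega>. L (X' \<omega>)) K"
      unfolding X'_def by (rule moment_le_refreshed_history[OF L_mom]) measurable
    have L'_X': "moment_le M 8 (\<lambda>\<omega>. L' (X' \<omega>)) K"
      unfolding X'_def by (rule moment_le_refreshed_history[OF L'_mom]) measurable
    have abs: "moment_le M 8 (\<lambda>\<omega>. \<bar>Y \<omega>\<bar>) A" if "moment_le M 8 Y A" for Y :: "'a \<Rightarrow> real" and A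
      using that by (rule moment_le_mono) (use moment_le_measurable[OF that] in auto)
    have "moment_le M 8 (\<lambda>\<omega>. \<bar>L' (X \<omega>)\<bar> + \<bar>L' (X' \<omega>)\<bar> + 1) (K + K + 1)"
      using L'_mom L'_X' by (intro moment_le_add abs moment_le_const) (auto simp: X_def)
    then have "moment_le M 4 (\<lambda>\<omega>. (\<bar>C\<bar> + 1) * ((\<bar>L' (X \<omega>)\<bar> + \<bar>L' (X' \<omega>)\<bar> + 1) * \<bar>X \<omega> - X' \<omega>\<bar>))
        ((\<bar>C\<bar> + 1) * ((K + K + 1) * (b * \<rho> ^ h)))"
      using abs[OF \<Delta>] by (intro moment_le_cmult moment_le_mult) auto
    moreover have "moment_le M 4 (\<lambda>\<omega>. (2 * \<bar>x\<bar> powr \<eta>) * (L (X' \<omega>) * \<bar>X \<omega> - X' \<omega>\<bar> powr \<eta>))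
        ((2 * w) * (K * (2 * (b * \<rho> ^ h) powr \<eta>)))"
      using L_X' moment_le_powr[OF \<Delta> \<eta>] w
      by (intro moment_le_cmult moment_le_mult) (simp_all, simp add: w_def)
    moreover have "moment_le M 4 Y A \<Longrightarrow> moment_le M 4 (\<lambda>\<omega>. \<bar>Y \<omega>\<bar>) A" for Y :: "'a \<Rightarrow> real" and A
      by (rule moment_le_mono) (auto dest: moment_le_measurable)
    ultimately have "moment_le M 4 (\<lambda>\<omega>. \<bar>(\<bar>C\<bar> + 1) * ((\<bar>L' (X \<omega>)\<bar> + \<bar>L' (X' \<omega>)\<bar> + 1) * \<bar>X \<omega> - X' \<omega>\<bar>)\<bar> +
         \<bar>(2 * \<bar>x\<bar> powr \<eta>) * (L (X' \<omega>) * \<bar>X \<omega> - X' \<omega>\<bar> powr \<eta>)\<bar>)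
       ((\<bar>C\<bar> + 1) * ((K + K + 1) * (b * \<rho> ^ h)) + (2 * w) * (K * (2 * (b * \<rho> ^ h) powr \<eta>)))"
      by (intro moment_le_add) auto
    then show ?thesis
    proof (rule moment_le_mono)
      \<comment> \<open>The Lipschitz part decays at the faster rate \<open>\<rho>\<close>; both parts are compared with \<open>\<rho> powr \<eta>\<close>.\<close>
      have rho_theta: "\<rho> ^ h \<le> ?\<theta> ^ h"
        using powr_mono'[of \<eta> 1 \<rho>] \<eta> \<rho> by (intro power_mono) auto
      have "(b * \<rho> ^ h) powr \<eta> = b powr \<eta> * ?\<theta> ^ h"
        using b \<rho> by (simp add: powr_mult powr_powr mult.commute flip: powr_realpow)
      also have "b powr \<eta> \<le> 1 + b"
      proof (cases "b \<le> 1")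
        case True
        then show ?thesis using b \<eta> powr_le1[of \<eta> b] by simp
      next
        case False
        then show ?thesis using powr_mono[of \<eta> 1 b] \<eta> by simp
      qed
      finally have b_eta: "(b * \<rho> ^ h) powr \<eta> \<le> (1 + b) * ?\<theta> ^ h"
        using \<theta> by simp
      have "(\<bar>C\<bar> + 1) * ((K + K + 1) * (b * \<rho> ^ h)) + (2 * w) * (K * (2 * (b * \<rho> ^ h) powr \<eta>))
        \<le> w * ((\<bar>C\<bar> + 1) * ((K + K + 1) * (b * ?\<theta> ^ h))) + (2 * w) * (K * (2 * ((1 + b) * ?\<theta> ^ h)))"
      proof (intro add_mono mult_left_mono b_eta)
        have "(\<bar>C\<bar> + 1) * ((K + K + 1) * (b * \<rho> ^ h)) \<le> (\<bar>C\<bar> + 1) * ((K + K + 1) * (b * ?\<theta> ^ h))"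
          using K b by (intro mult_left_mono rho_theta) auto
        also have "\<dots> = 1 * ((\<bar>C\<bar> + 1) * ((K + K + 1) * (b * ?\<theta> ^ h)))" by simp
        also have "\<dots> \<le> w * ((\<bar>C\<bar> + 1) * ((K + K + 1) * (b * ?\<theta> ^ h)))"
          using w K b \<theta> by (intro mult_right_mono) auto
        finally show "(\<bar>C\<bar> + 1) * ((K + K + 1) * (b * \<rho> ^ h)) \<le> w * ((\<bar>C\<bar> + 1) * ((K + K + 1) * (b * ?\<theta> ^ h)))" .
      qed (use K w in auto)
      also have "\<dots> = ((\<bar>C\<bar> + 1) * (2 * K + 1) * b + 4 * K * (1 + b)) * (w * ?\<theta> ^ h)"
        by (simp add: algebra_simps)
      also have "\<dots> \<le> B * (w * ?\<theta> ^ h)"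
        using w \<theta> by (intro mult_right_mono B(3)) auto
      finally show "(\<bar>C\<bar> + 1) * ((K + K + 1) * (b * \<rho> ^ h)) + (2 * w) * (K * (2 * (b * \<rho> ^ h) powr \<eta>))
          \<le> B * w * ?\<theta> ^ nat (k - s)" by (simp add: h_def mult_ac)
      fix \<omega>
      have "\<psi> (history eps k \<omega>) - \<psi> (refreshed_history s k \<omega>)
         = complex_of_real (L (X \<omega>) - L (X' \<omega>)) * iexp (x * X \<omega>) +
           complex_of_real (L (X' \<omega>)) * (iexp (x * X \<omega>) - iexp (x * X' \<omega>))"
        by (simp add: \<psi>_def X_def X'_def algebra_simps)
      then have "norm (\<psi> (history eps k \<omega>) - \<psi> (refreshed_history s k \<omega>))
         \<le> \<bar>L (X \<omega>) - L (X' \<omega>)\<bar> + \<bar>L (X' \<omega>)\<bar> * norm (iexp (x * X \<omega>) - iexp (x * X' \<omega>))"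
        by (metis (no_types, lifting) mult.right_neutral norm_exp_i_times norm_mult norm_of_real norm_triangle_ineq)
      moreover have "\<bar>L (X \<omega>) - L (X' \<omega>)\<bar> \<le> (\<bar>C\<bar> + 1) * ((\<bar>L' (X \<omega>)\<bar> + \<bar>L' (X' \<omega>)\<bar> + 1) * \<bar>X \<omega> - X' \<omega>\<bar>)"
        by (rule order_trans[OF diff_le_derivative_bound[OF deriv bound]]) (auto intro!: mult_right_mono)
      moreover have "norm (iexp (x * X \<omega>) - iexp (x * X' \<omega>)) \<le> 2 * \<bar>x\<bar> powr \<eta> * \<bar>X \<omega> - X' \<omega>\<bar> powr \<eta>"
        using norm_iexp_diff_le[OF \<eta>, of "x * X \<omega>" "x * X' \<omega>"]
        by (simp add: abs_mult powr_mult flip: right_diff_distrib)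
      then have "\<bar>L (X' \<omega>)\<bar> * norm (iexp (x * X \<omega>) - iexp (x * X' \<omega>))
          \<le> \<bar>L (X' \<omega>)\<bar> * (2 * \<bar>x\<bar> powr \<eta> * \<bar>X \<omega> - X' \<omega>\<bar> powr \<eta>)"
        by (intro mult_left_mono) auto
      ultimately have "norm (\<psi> (history eps k \<omega>) - \<psi> (refreshed_history s k \<omega>))
          \<le> (\<bar>C\<bar> + 1) * ((\<bar>L' (X \<omega>)\<bar> + \<bar>L' (X' \<omega>)\<bar> + 1) * \<bar>X \<omega> - X' \<omega>\<bar>) +
            \<bar>L (X' \<omega>)\<bar> * (2 * \<bar>x\<bar> powr \<eta> * \<bar>X \<omega> - X' \<omega>\<bar> powr \<eta>)"
        by linarith
      then show "norm (\<psi> (history eps k \<omega>) - \<psi> (refreshed_history s k \<omega>))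
        \<le> norm (\<bar>(\<bar>C\<bar> + 1) * ((\<bar>L' (X \<omega>)\<bar> + \<bar>L' (X' \<omega>)\<bar> + 1) * \<bar>X \<omega> - X' \<omega>\<bar>)\<bar> +
           \<bar>(2 * \<bar>x\<bar> powr \<eta>) * (L (X' \<omega>) * \<bar>X \<omega> - X' \<omega>\<bar> powr \<eta>)\<bar>)"
        by (simp add: abs_mult mult_ac)
    qed auto
  qed
  show ?thesis
    using size diff by (simp add: geometric_coupling_def \<psi>_def w_def)
qed

end

section \<open>Variance of a weighted quadratic form\<close>

text \<open>Schur's test for a symmetric kernel with bounded row sums.\<close>

lemma schur_bound:
  fixes a :: "'i \<Rightarrow> real"
  assumes "finite I" and nonneg: "\<And>i j. i \<in> I \<Longrightarrow> j \<in> I \<Longrightarrow> 0 \<le> c i j"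
    and sym: "\<And>i j. i \<in> I \<Longrightarrow> j \<in> I \<Longrightarrow> c i j = c j i"
    and row: "\<And>i. i \<in> I \<Longrightarrow> (\<Sum>j\<in>I. c i j) \<le> K"
  shows "(\<Sum>i\<in>I. \<Sum>j\<in>I. \<bar>a i\<bar> * \<bar>a j\<bar> * c i j) \<le> K * (\<Sum>i\<in>I. (a i)\<^sup>2)"
proof -
  have "(\<Sum>i\<in>I. \<Sum>j\<in>I. \<bar>a i\<bar> * \<bar>a j\<bar> * c i j)
      \<le> (\<Sum>i\<in>I. \<Sum>j\<in>I. 1/2 * ((a i)\<^sup>2 * c i j) + 1/2 * ((a j)\<^sup>2 * c j i))"
  proof (intro sum_mono)
    fix i j assume ij: "i \<in> I" "j \<in> I"
    have "\<bar>a i\<bar> * \<bar>a j\<bar> \<le> ((a i)\<^sup>2 + (a j)\<^sup>2) / 2"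
      using sum_squares_bound[of "\<bar>a i\<bar>" "\<bar>a j\<bar>"] by simp
    then have "\<bar>a i\<bar> * \<bar>a j\<bar> * c i j \<le> ((a i)\<^sup>2 + (a j)\<^sup>2) / 2 * c i j"
      by (intro mult_right_mono nonneg ij)
    then show "\<bar>a i\<bar> * \<bar>a j\<bar> * c i j \<le> 1/2 * ((a i)\<^sup>2 * c i j) + 1/2 * ((a j)\<^sup>2 * c j i)"
      using sym[OF ij] by (simp add: algebra_simps)
  qed
  also have "\<dots> = 1/2 * (\<Sum>i\<in>I. \<Sum>j\<in>I. (a i)\<^sup>2 * c i j) + 1/2 * (\<Sum>i\<in>I. \<Sum>j\<in>I. (a j)\<^sup>2 * c j i)"
    by (simp add: sum.distrib sum_distrib_left)
  also have "(\<Sum>i\<in>I. \<Sum>j\<in>I. (a j)\<^sup>2 * c j i) = (\<Sum>i\<in>I. \<Sum>j\<in>I. (a i)\<^sup>2 * c i j)"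
    by (rule sum.swap)
  also have "1/2 * (\<Sum>i\<in>I. \<Sum>j\<in>I. (a i)\<^sup>2 * c i j) + 1/2 * (\<Sum>i\<in>I. \<Sum>j\<in>I. (a i)\<^sup>2 * c i j)
      = (\<Sum>i\<in>I. (a i)\<^sup>2 * (\<Sum>j\<in>I. c i j))"
    by (simp add: sum_distrib_left)
  also have "\<dots> \<le> (\<Sum>i\<in>I. (a i)\<^sup>2 * K)"
    by (intro sum_mono mult_left_mono row) auto
  finally show ?thesis by (simp add: sum_distrib_left mult.commute)
qed

lemma (in prob_space) second_moment_weighted_sum:
  fixes Q :: "'i \<Rightarrow> 'a \<Rightarrow> complex" and a :: "'i \<Rightarrow> real"
  assumes "finite I" and Q: "\<And>i. i \<in> I \<Longrightarrow> moment_le M 2 (Q i) A"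
    and corr: "\<And>i j. i \<in> I \<Longrightarrow> j \<in> I \<Longrightarrow> norm (\<integral>\<omega>. Q i \<omega> * cnj (Q j \<omega>) \<partial>M) \<le> c i j"
    and sym: "\<And>i j. i \<in> I \<Longrightarrow> j \<in> I \<Longrightarrow> c i j = c j i"
    and row: "\<And>i. i \<in> I \<Longrightarrow> (\<Sum>j\<in>I. c i j) \<le> K"
  shows "(\<integral>\<^sup>+\<omega>. ennreal ((norm (\<Sum>i\<in>I. complex_of_real (a i) * Q i \<omega>))\<^sup>2) \<partial>M)
    \<le> ennreal (K * (\<Sum>i\<in>I. (a i)\<^sup>2))"
proof -
  have cnj_meas: "cnj \<in> borel_measurable borel"
    by (intro borel_measurable_continuous_onI continuous_intros)
  have cQ: "moment_le M 2 (\<lambda>\<omega>. cnj (Q i \<omega>)) A" if "i \<in> I" for i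
    by (rule moment_le_mono[OF Q[OF that]])
      (use measurable_compose[OF moment_le_measurable[OF Q[OF that]] cnj_meas] in auto)
  have int: "integrable M (\<lambda>\<omega>. Q i \<omega> * cnj (Q j \<omega>))" if "i \<in> I" "j \<in> I" for i j
    using moment_le_mult[of M 1 "Q i" A, OF _ ] Q[OF that(1)] cQ[OF that(2)]
    by (intro moment_le_1_integral(1)[of M _ "A * A"]) simp
  let ?S = "\<lambda>\<omega>. \<Sum>i\<in>I. complex_of_real (a i) * Q i \<omega>"
  have expand: "(norm (?S \<omega>))\<^sup>2 = Re (\<Sum>i\<in>I. \<Sum>j\<in>I. complex_of_real (a i * a j) * (Q i \<omega> * cnj (Q j \<omega>)))" for \<omega>
  proof -
    have "?S \<omega> * cnj (?S \<omega>) = (\<Sum>i\<in>I. \<Sum>j\<in>I. complex_of_real (a i * a j) * (Q i \<omega> * cnj (Q j \<omega>)))"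
      by (simp add: sum_product mult_ac)
    then show ?thesis using complex_norm_square[of "?S \<omega>"] by (metis Re_complex_of_real)
  qed
  have int_sq: "integrable M (\<lambda>\<omega>. (norm (?S \<omega>))\<^sup>2)"
    unfolding expand using int by (intro integrable_Re Bochner_Integration.integrable_sum integrable_mult_right) auto
  have "(\<integral>\<omega>. (norm (?S \<omega>))\<^sup>2 \<partial>M)
      = Re (\<integral>\<omega>. (\<Sum>i\<in>I. \<Sum>j\<in>I. complex_of_real (a i * a j) * (Q i \<omega> * cnj (Q j \<omega>))) \<partial>M)"
    unfolding expand using int
    by (intro integral_Re Bochner_Integration.integrable_sum integrable_mult_right) auto
  also have "\<dots> = Re (\<Sum>i\<in>I. \<Sum>j\<in>I. complex_of_real (a i * a j) * (\<integral>\<omega>. Q i \<omega> * cnj (Q j \<omega>) \<partial>M))"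
    using int by (simp add: Bochner_Integration.integral_sum Bochner_Integration.integrable_sum)
  also have "\<dots> \<le> norm (\<Sum>i\<in>I. \<Sum>j\<in>I. complex_of_real (a i * a j) * (\<integral>\<omega>. Q i \<omega> * cnj (Q j \<omega>) \<partial>M))"
    by (rule complex_Re_le_cmod)
  also have "\<dots> \<le> (\<Sum>i\<in>I. \<Sum>j\<in>I. \<bar>a i\<bar> * \<bar>a j\<bar> * c i j)"
    by (intro sum_norm_le) (auto simp: norm_mult abs_mult intro!: mult_left_mono corr)
  also have "\<dots> \<le> K * (\<Sum>i\<in>I. (a i)\<^sup>2)"
    using corr by (intro schur_bound \<open>finite I\<close> sym row) (auto intro: order_trans[OF norm_ge_zero])
  finally show ?thesis
    by (subst nn_integral_eq_integral[OF int_sq]) (auto intro: ennreal_leI)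
qed

lemma geometric_row_sum:
  fixes q :: real
  assumes q: "0 < q" "q < 1"
  shows "(\<Sum>l=1..n. q ^ nat \<bar>int k - int l\<bar>) \<le> 2 / (1 - q)"
proof -
  have half: "(\<Sum>l\<in>S. q ^ f l) \<le> 1 / (1 - q)" if "finite S" "inj_on f S" for S and f :: "nat \<Rightarrow> nat"
  proof -
    have "(\<Sum>l\<in>S. q ^ f l) = (\<Sum>i\<in>f ` S. q ^ i)" using that by (simp add: sum.reindex)
    also have "\<dots> \<le> (\<Sum>i. q ^ i)"
      using q that by (intro sum_le_suminf summable_geometric) auto
    finally show ?thesis using q by (simp add: suminf_geometric)
  qed
  have "(\<Sum>l=1..n. q ^ nat \<bar>int k - int l\<bar>)
      = (\<Sum>l\<in>{l\<in>{1..n}. l \<le> k}. q ^ nat \<bar>int k - int l\<bar>) + (\<Sum>l\<in>{l\<in>{1..n}. k < l}. q ^ nat \<bar>int k - int l\<bar>)"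
    by (subst sum.union_disjoint[symmetric]) (auto intro!: sum.cong)
  also have "\<dots> \<le> 1 / (1 - q) + 1 / (1 - q)"
    by (intro add_mono half) (auto simp: inj_on_def)
  finally show ?thesis by simp
qed

context innovations
begin

text \<open>The kernel of the quadratic form is dominated by a sum of two products of geometric kernels,
one for each way of matching the two pairs of indices.\<close>

lemma variance_quadratic_form:
  fixes \<phi> \<psi> :: "nat \<Rightarrow> (nat \<Rightarrow> real) \<Rightarrow> complex" and a :: "nat \<Rightarrow> nat \<Rightarrow> real"
  assumes \<phi>: "\<And>k. k \<in> {1..n} \<Longrightarrow> geometric_coupling (\<phi> k) (int k) B w (q ^ 4)"
    and \<psi>: "\<And>k. k \<in> {1..n} \<Longrightarrow> geometric_coupling (\<psi> k) (int k) B w (q ^ 4)"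
    and \<phi>0: "\<And>k. k \<in> {1..n} \<Longrightarrow> (\<integral>\<omega>. \<phi> k (history eps (int k) \<omega>) \<partial>M) = 0"
    and \<psi>0: "\<And>k. k \<in> {1..n} \<Longrightarrow> (\<integral>\<omega>. \<psi> k (history eps (int k) \<omega>) \<partial>M) = 0"
    and B: "1 \<le> B" and w: "0 < w" and q: "0 < q" "q < 1"
  defines "S \<equiv> \<lambda>\<omega>. \<Sum>k=1..n. \<Sum>j=1..n. complex_of_real (a k j) *
      \<phi> k (history eps (int k) \<omega>) * \<psi> j (history eps (int j) \<omega>)"
  shows "(\<integral>\<^sup>+\<omega>. ennreal ((norm (S \<omega> - (\<integral>\<omega>'. S \<omega>' \<partial>M)))\<^sup>2) \<partial>M)
      \<le> ennreal (64 * B ^ 6 / (1 - q)\<^sup>2 * (\<Sum>k=1..n. \<Sum>j=1..n. (a k j)\<^sup>2) * w)"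
    and "(\<integral>\<^sup>+\<omega>. ennreal (norm (S \<omega>)) \<partial>M) \<le> ennreal (\<Sum>k=1..n. \<Sum>j=1..n. \<bar>a k j\<bar> * B\<^sup>2)"
proof -
  define P where "P = (\<lambda>(k, j) \<omega>. \<phi> k (history eps (int k) \<omega>) * \<psi> j (history eps (int j) \<omega>))"
  define Q where "Q p \<omega> = P p \<omega> - (\<integral>\<omega>'. P p \<omega>' \<partial>M)" for p \<omega>
  define I where "I = {1..n} \<times> {1..n}"
  define \<alpha> where "\<alpha> p = a (fst p) (snd p)" for p
  have P2: "moment_le M 2 (P p) (B\<^sup>2)" if "p \<in> I" for p
    using that \<phi> \<psi> moment_le_mult[of M 2 "\<lambda>\<omega>. \<phi> (fst p) (history eps (int (fst p)) \<omega>)" B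
        "\<lambda>\<omega>. \<psi> (snd p) (history eps (int (snd p)) \<omega>)" B]
    by (auto simp: P_def I_def geometric_coupling_def power2_eq_square)
  have P1: "moment_le M 1 (P p) (B\<^sup>2)" if "p \<in> I" for p
    using moment_le_halve[of 1 "P p"] P2[OF that] by simp
  have int_P: "integrable M (P p)" if "p \<in> I" for p
    using moment_le_1_integral(1)[OF P1[OF that]] .
  have Q2: "moment_le M 2 (Q p) (B\<^sup>2 + B\<^sup>2)" if "p \<in> I" for p
  proof -
    have "moment_le M 2 (\<lambda>\<omega>. P p \<omega> + - (\<integral>\<omega>'. P p \<omega>' \<partial>M)) (B\<^sup>2 + B\<^sup>2)"
      using moment_le_1_integral(2)[OF P1[OF that]] B
      by (intro moment_le_add P2 that moment_le_const) auto
    then show ?thesis by (simp add: Q_def[abs_def])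
  qed
  have S: "S \<omega> = (\<Sum>p\<in>I. complex_of_real (\<alpha> p) * P p \<omega>)" for \<omega>
    by (simp add: S_def I_def \<alpha>_def P_def sum.cartesian_product split_beta mult.assoc)
  have "(\<integral>\<omega>. S \<omega> \<partial>M) = (\<Sum>p\<in>I. complex_of_real (\<alpha> p) * (\<integral>\<omega>. P p \<omega> \<partial>M))"
    using int_P by (simp add: S Bochner_Integration.integral_sum)
  then have S_centred: "S \<omega> - (\<integral>\<omega>'. S \<omega>' \<partial>M) = (\<Sum>p\<in>I. complex_of_real (\<alpha> p) * Q p \<omega>)" for \<omega>
    by (simp add: S Q_def right_diff_distrib sum_subtractf)
  define e where "e i j = q ^ nat \<bar>int i - int j\<bar>" for i j :: nat
  define c where "c p p' = 8 * B ^ 6 * w * (e (fst p) (fst p') * e (snd p) (snd p') + e (fst p) (snd p') * e (snd p) (fst p'))"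
    for p p' :: "nat \<times> nat"
  have e_sym: "e i j = e j i" for i j by (simp add: e_def abs_minus_commute)
  have "norm (\<integral>\<omega>. Q p \<omega> * cnj (Q p' \<omega>) \<partial>M) \<le> c p p'" if p: "p \<in> I" and p': "p' \<in> I" for p p'
  proof -
    obtain k j where kj: "p = (k, j)" "k \<in> {1..n}" "j \<in> {1..n}" using p by (auto simp: I_def)
    obtain l m where lm: "p' = (l, m)" "l \<in> {1..n}" "m \<in> {1..n}" using p' by (auto simp: I_def)
    define \<Phi> where "\<Phi> = (\<lambda>i::nat. if i = 0 then \<phi> k else if i = 1 then \<psi> j
      else if i = 2 then (\<lambda>x. cnj (\<phi> l x)) else (\<lambda>x. cnj (\<psi> m x)))"
    define t where "t = (\<lambda>i::nat. if i = 0 then int k else if i = 1 then int j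
      else if i = 2 then int l else int m)"
    have cpl: "geometric_coupling (\<Phi> i) (t i) B w (q ^ 4)" for i
      using \<phi> \<psi> kj lm by (auto simp: \<Phi>_def t_def intro!: geometric_coupling_cnj)
    have cen: "(\<integral>\<omega>. \<Phi> i (history eps (t i) \<omega>) \<partial>M) = 0" for i
      using \<phi>0 \<psi>0 kj lm by (auto simp: \<Phi>_def t_def)
    have int_cnj: "integrable M (\<lambda>\<omega>. cnj (P p' \<omega>))" using int_P[OF p'] by simp
    have int_PP: "integrable M (\<lambda>\<omega>. P p \<omega> * cnj (P p' \<omega>))"
    proof -
      have "moment_le M 2 (\<lambda>\<omega>. cnj (P p' \<omega>)) (B\<^sup>2)"
        by (rule moment_le_mono[OF P2[OF p']]) (use borel_measurable_integrable[OF int_cnj] in auto)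
      then show ?thesis
        using moment_le_mult[of M 1 "P p" "B\<^sup>2" "\<lambda>\<omega>. cnj (P p' \<omega>)" "B\<^sup>2"] P2[OF p]
        by (intro moment_le_1_integral(1)[of M _ "B\<^sup>2 * B\<^sup>2"]) simp
    qed
    have "(\<integral>\<omega>. Q p \<omega> * cnj (Q p' \<omega>) \<partial>M)
        = (\<integral>\<omega>. P p \<omega> * cnj (P p' \<omega>) \<partial>M) - (\<integral>\<omega>. P p \<omega> \<partial>M) * (\<integral>\<omega>. cnj (P p' \<omega>) \<partial>M)"
    proof -
      have "(\<integral>\<omega>. Q p \<omega> * cnj (Q p' \<omega>) \<partial>M) = (\<integral>\<omega>. P p \<omega> * cnj (P p' \<omega>) - (\<integral>\<omega>. P p \<omega> \<partial>M) * cnj (P p' \<omega>)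
          - (P p \<omega> * (\<integral>\<omega>. cnj (P p' \<omega>) \<partial>M) - (\<integral>\<omega>. P p \<omega> \<partial>M) * (\<integral>\<omega>. cnj (P p' \<omega>) \<partial>M)) \<partial>M)"
        by (simp add: Q_def algebra_simps)
      also have "\<dots> = (\<integral>\<omega>. P p \<omega> * cnj (P p' \<omega>) \<partial>M) - (\<integral>\<omega>. P p \<omega> \<partial>M) * (\<integral>\<omega>. cnj (P p' \<omega>) \<partial>M)"
        using int_PP int_P[OF p] int_cnj by (simp add: prob_space)
      finally show ?thesis .
    qed
    also have "norm \<dots> \<le> c p p'"
      using covariance_bound[of \<Phi> t B w q, OF cpl B w q(1) _ cen] q
      by (simp add: \<Phi>_def t_def P_def kj lm c_def e_def)
    finally show ?thesis .
  qed
  moreover have "c p p' = c p' p" for p p'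
    by (simp add: c_def e_sym[of "fst p'"] e_sym[of "snd p'"] mult.commute add.commute)
  moreover have "(\<Sum>p'\<in>I. c p p') \<le> 64 * B ^ 6 / (1 - q)\<^sup>2 * w" if "p \<in> I" for p
  proof -
    have row: "(\<Sum>l=1..n. e i l) \<le> 2 / (1 - q)" for i
      unfolding e_def by (rule geometric_row_sum[OF q])
    have "(\<Sum>p'\<in>I. e i (fst p') * e j (snd p')) \<le> (2 / (1 - q)) * (2 / (1 - q))" for i j
    proof -
      have "(\<Sum>p'\<in>I. e i (fst p') * e j (snd p')) = (\<Sum>l=1..n. e i l) * (\<Sum>m=1..n. e j m)"
        by (simp add: I_def sum_product sum.cartesian_product split_beta)
      also have "\<dots> \<le> (2 / (1 - q)) * (2 / (1 - q))"
        using q by (intro mult_mono row sum_nonneg) (auto simp: e_def)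
      finally show ?thesis .
    qed
    from this[of "fst p" "snd p"] this[of "snd p" "fst p"]
    have "(\<Sum>p'\<in>I. e (fst p) (fst p') * e (snd p) (snd p') + e (fst p) (snd p') * e (snd p) (fst p'))
        \<le> 2 * (4 / (1 - q)\<^sup>2)"
      by (simp add: sum.distrib power2_eq_square mult.commute)
    then have "8 * B ^ 6 * w * (\<Sum>p'\<in>I. e (fst p) (fst p') * e (snd p) (snd p') + e (fst p) (snd p') * e (snd p) (fst p'))
        \<le> 8 * B ^ 6 * w * (2 * (4 / (1 - q)\<^sup>2))"
      using B w by (intro mult_left_mono) auto
    then show ?thesis by (simp add: c_def sum_distrib_left[symmetric] mult_ac)
  qed
  ultimately have "(\<integral>\<^sup>+\<omega>. ennreal ((norm (\<Sum>p\<in>I. complex_of_real (\<alpha> p) * Q p \<omega>))\<^sup>2) \<partial>M)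
      \<le> ennreal (64 * B ^ 6 / (1 - q)\<^sup>2 * w * (\<Sum>p\<in>I. (\<alpha> p)\<^sup>2))"
    by (intro second_moment_weighted_sum[where A = "B\<^sup>2 + B\<^sup>2" and c = c] Q2) (auto simp: I_def)
  then show "(\<integral>\<^sup>+\<omega>. ennreal ((norm (S \<omega> - (\<integral>\<omega>'. S \<omega>' \<partial>M)))\<^sup>2) \<partial>M)
      \<le> ennreal (64 * B ^ 6 / (1 - q)\<^sup>2 * (\<Sum>k=1..n. \<Sum>j=1..n. (a k j)\<^sup>2) * w)"
    by (simp add: S_centred I_def \<alpha>_def sum.cartesian_product split_beta mult_ac)
  have "(\<integral>\<^sup>+\<omega>. ennreal (norm (S \<omega>)) \<partial>M) \<le> (\<integral>\<^sup>+\<omega>. (\<Sum>p\<in>I. ennreal \<bar>\<alpha> p\<bar> * ennreal (norm (P p \<omega>))) \<partial>M)"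
  proof (rule nn_integral_mono)
    fix \<omega>
    have "norm (S \<omega>) \<le> (\<Sum>p\<in>I. \<bar>\<alpha> p\<bar> * norm (P p \<omega>))"
      unfolding S by (rule sum_norm_le) (simp add: norm_mult)
    then show "ennreal (norm (S \<omega>)) \<le> (\<Sum>p\<in>I. ennreal \<bar>\<alpha> p\<bar> * ennreal (norm (P p \<omega>)))"
      by (simp add: ennreal_leI flip: ennreal_mult)
  qed
  also have "\<dots> = (\<Sum>p\<in>I. ennreal \<bar>\<alpha> p\<bar> * (\<integral>\<^sup>+\<omega>. ennreal (norm (P p \<omega>)) \<partial>M))"
    using moment_le_measurable[OF P1] by (subst nn_integral_sum) (auto intro!: sum.cong nn_integral_cmult)
  also have "\<dots> \<le> (\<Sum>p\<in>I. ennreal \<bar>\<alpha> p\<bar> * ennreal (B\<^sup>2))"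
    using P1 by (intro sum_mono mult_left_mono) (auto simp: moment_le_def)
  also have "\<dots> = ennreal (\<Sum>p\<in>I. \<bar>\<alpha> p\<bar> * B\<^sup>2)"
    by (simp flip: ennreal_mult)
  finally show "(\<integral>\<^sup>+\<omega>. ennreal (norm (S \<omega>)) \<partial>M) \<le> ennreal (\<Sum>k=1..n. \<Sum>j=1..n. \<bar>a k j\<bar> * B\<^sup>2)"
    by (simp add: I_def \<alpha>_def sum.cartesian_product split_beta)
qed

end

section \<open>Averaging over frequencies\<close>

text \<open>Minkowski's integral inequality in the form needed here. Since the variance bound is linear in
\<open>w\<close>, the Cauchy--Schwarz inequality with respect to the density \<open>|g|\<close> suffices.\<close>

lemma (in prob_space) variance_of_mixture:
  fixes g :: "'z \<Rightarrow> complex" and S :: "'z \<Rightarrow> 'a \<Rightarrow> complex"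
  assumes "sigma_finite_measure N"
    and g: "integrable N g"
    and S[measurable]: "(\<lambda>(\<omega>, z). S z \<omega>) \<in> borel_measurable (M \<Otimes>\<^sub>M N)"
    and L1: "\<And>z. (\<integral>\<^sup>+\<omega>. ennreal (norm (S z \<omega>)) \<partial>M) \<le> ennreal A"
    and var: "\<And>z. (\<integral>\<^sup>+\<omega>. ennreal ((norm (S z \<omega> - (\<integral>\<omega>'. S z \<omega>' \<partial>M)))\<^sup>2) \<partial>M) \<le> ennreal (V * w z)"
    and w: "integrable N (\<lambda>z. w z * norm (g z))" "\<And>z. 0 \<le> w z" "0 \<le> V"
  defines "D \<equiv> \<lambda>\<omega>. \<integral>z. g z * S z \<omega> \<partial>N"
  shows "(\<integral>\<^sup>+\<omega>. ennreal ((norm (D \<omega> - (\<integral>\<omega>'. D \<omega>' \<partial>M)))\<^sup>2) \<partial>M)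
    \<le> ennreal ((\<integral>z. norm (g z) \<partial>N) * (V * (\<integral>z. w z * norm (g z) \<partial>N)))"
proof -
  interpret N: sigma_finite_measure N by fact
  interpret pair_sigma_finite M N ..
  have [measurable]: "g \<in> borel_measurable N" using g by auto
  define m where "m z = (\<integral>\<omega>. S z \<omega> \<partial>M)" for z
  have S_swap[measurable]: "(\<lambda>(z, \<omega>). S z \<omega>) \<in> borel_measurable (N \<Otimes>\<^sub>M M)"
    using measurable_compose[OF measurable_pair_swap' S] by (simp add: split_beta)
  have m[measurable]: "m \<in> borel_measurable N"
    unfolding m_def by measurable
  have S_z[measurable]: "S z \<in> borel_measurable M" if "z \<in> space N" for z
    using measurable_compose_Pair1[OF that S_swap] by simp
  have norm_g: "(\<integral>\<^sup>+z. ennreal (norm (g z)) \<partial>N) = ennreal (\<integral>z. norm (g z) \<partial>N)"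
    using g by (intro nn_integral_eq_integral) auto
  have gS: "integrable (M \<Otimes>\<^sub>M N) (\<lambda>(\<omega>, z). g z * S z \<omega>)"
  proof (rule integrableI_bounded)
    have "(\<integral>\<^sup>+x. ennreal (norm (case x of (\<omega>, z) \<Rightarrow> g z * S z \<omega>)) \<partial>(M \<Otimes>\<^sub>M N))
        = (\<integral>\<^sup>+z. (\<integral>\<^sup>+\<omega>. ennreal (norm (g z)) * ennreal (norm (S z \<omega>)) \<partial>M) \<partial>N)"
      by (subst nn_integral_snd[symmetric]) (auto simp: norm_mult ennreal_mult)
    also have "\<dots> = (\<integral>\<^sup>+z. ennreal (norm (g z)) * (\<integral>\<^sup>+\<omega>. ennreal (norm (S z \<omega>)) \<partial>M) \<partial>N)"
      by (intro nn_integral_cong nn_integral_cmult) auto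
    also have "\<dots> \<le> (\<integral>\<^sup>+z. ennreal (norm (g z)) * ennreal A \<partial>N)"
      by (intro nn_integral_mono mult_left_mono L1) auto
    also have "\<dots> = ennreal (\<integral>z. norm (g z) \<partial>N) * ennreal A"
      by (simp add: nn_integral_multc norm_g)
    also have "\<dots> < \<infinity>" by (simp add: ennreal_mult_less_top)
    finally show "(\<integral>\<^sup>+x. ennreal (norm (case x of (\<omega>, z) \<Rightarrow> g z * S z \<omega>)) \<partial>(M \<Otimes>\<^sub>M N)) < \<infinity>" .
  qed measurable
  have mean: "(\<integral>\<omega>. D \<omega> \<partial>M) = (\<integral>z. g z * m z \<partial>N)"
    using Fubini_integral[OF gS] by (simp add: D_def m_def)
  have int_m: "integrable N (\<lambda>z. g z * m z)"
    using integrable_snd[OF gS] by (simp add: m_def)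
  have [measurable]: "D \<in> borel_measurable M"
    unfolding D_def by measurable
  have centred: "AE \<omega> in M. D \<omega> - (\<integral>\<omega>'. D \<omega>' \<partial>M) = (\<integral>z. g z * (S z \<omega> - m z) \<partial>N)"
    using AE_integrable_fst[OF gS]
  proof eventually_elim
    case (elim \<omega>)
    then show ?case
      unfolding mean using int_m
      by (simp add: D_def right_diff_distrib)
  qed
  have jensen: "ennreal ((norm (\<integral>z. g z * (S z \<omega> - m z) \<partial>N))\<^sup>2)
      \<le> (\<integral>\<^sup>+z. ennreal (norm (g z)) \<partial>N) * (\<integral>\<^sup>+z. ennreal (norm (g z)) * ennreal ((norm (S z \<omega> - m z))\<^sup>2) \<partial>N)"
    if \<omega>: "\<omega> \<in> space M" for \<omega>
  proof -
    have [measurable]: "(\<lambda>z. S z \<omega>) \<in> borel_measurable N"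
      using measurable_compose_Pair1[OF \<omega> S] by simp
    let ?a = "\<lambda>z. ennreal (sqrt (norm (g z)))"
    let ?b = "\<lambda>z. ennreal (sqrt (norm (g z)) * norm (S z \<omega> - m z))"
    have ab: "?a z * ?b z = ennreal (norm (g z * (S z \<omega> - m z)))" for z
      by (simp flip: ennreal_mult add: norm_mult mult.assoc[symmetric] real_sqrt_mult_self)
    have "ennreal (norm (\<integral>z. g z * (S z \<omega> - m z) \<partial>N)) \<le> (\<integral>\<^sup>+z. ?a z * ?b z \<partial>N)"
      unfolding ab by (cases "integrable N (\<lambda>z. g z * (S z \<omega> - m z))")
        (auto simp: integral_norm_bound_ennreal not_integrable_integral_eq)
    then have "ennreal ((norm (\<integral>z. g z * (S z \<omega> - m z) \<partial>N))\<^sup>2) \<le> (\<integral>\<^sup>+z. ?a z * ?b z \<partial>N)\<^sup>2"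
      by (subst ennreal_power[symmetric]) (auto intro: power_mono)
    also have "\<dots> \<le> (\<integral>\<^sup>+z. ?a z ^ 2 \<partial>N) * (\<integral>\<^sup>+z. ?b z ^ 2 \<partial>N)"
      by (intro Cauchy_Schwarz_nn_integral) measurable
    also have "\<dots> = (\<integral>\<^sup>+z. ennreal (norm (g z)) \<partial>N) *
        (\<integral>\<^sup>+z. ennreal (norm (g z)) * ennreal ((norm (S z \<omega> - m z))\<^sup>2) \<partial>N)"
      by (simp add: ennreal_power power_mult_distrib flip: ennreal_mult)
    finally show ?thesis .
  qed
  have "(\<integral>\<^sup>+\<omega>. ennreal ((norm (D \<omega> - (\<integral>\<omega>'. D \<omega>' \<partial>M)))\<^sup>2) \<partial>M)
      = (\<integral>\<^sup>+\<omega>. ennreal ((norm (\<integral>z. g z * (S z \<omega> - m z) \<partial>N))\<^sup>2) \<partial>M)"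
    using centred by (intro nn_integral_cong_AE) (auto elim!: eventually_mono)
  also have "\<dots> \<le> (\<integral>\<^sup>+\<omega>. (\<integral>\<^sup>+z. ennreal (norm (g z)) \<partial>N) *
      (\<integral>\<^sup>+z. ennreal (norm (g z)) * ennreal ((norm (S z \<omega> - m z))\<^sup>2) \<partial>N) \<partial>M)"
    by (intro nn_integral_mono jensen)
  also have "\<dots> = (\<integral>\<^sup>+z. ennreal (norm (g z)) \<partial>N) *
      (\<integral>\<^sup>+\<omega>. (\<integral>\<^sup>+z. ennreal (norm (g z)) * ennreal ((norm (S z \<omega> - m z))\<^sup>2) \<partial>N) \<partial>M)"
    by (intro nn_integral_cmult) measurable
  also have "(\<integral>\<^sup>+\<omega>. (\<integral>\<^sup>+z. ennreal (norm (g z)) * ennreal ((norm (S z \<omega> - m z))\<^sup>2) \<partial>N) \<partial>M)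
      = (\<integral>\<^sup>+z. (\<integral>\<^sup>+\<omega>. ennreal (norm (g z)) * ennreal ((norm (S z \<omega> - m z))\<^sup>2) \<partial>M) \<partial>N)"
    by (rule Fubini'[symmetric]) measurable
  also have "\<dots> = (\<integral>\<^sup>+z. ennreal (norm (g z)) * (\<integral>\<^sup>+\<omega>. ennreal ((norm (S z \<omega> - m z))\<^sup>2) \<partial>M) \<partial>N)"
    by (intro nn_integral_cong nn_integral_cmult) auto
  also have "\<dots> \<le> (\<integral>\<^sup>+z. ennreal (norm (g z)) * ennreal (V * w z) \<partial>N)"
    unfolding m_def by (intro nn_integral_mono mult_left_mono var) auto
  also have "\<dots> = (\<integral>\<^sup>+z. ennreal (V * (w z * norm (g z))) \<partial>N)"
    using w by (intro nn_integral_cong) (simp flip: ennreal_mult add: mult_ac)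
  also have "\<dots> = ennreal (V * (\<integral>z. w z * norm (g z) \<partial>N))"
    using w by (subst nn_integral_eq_integral) auto
  finally show "(\<integral>\<^sup>+\<omega>. ennreal ((norm (D \<omega> - (\<integral>\<omega>'. D \<omega>' \<partial>M)))\<^sup>2) \<partial>M)
    \<le> ennreal ((\<integral>z. norm (g z) \<partial>N) * (V * (\<integral>z. w z * norm (g z) \<partial>N)))"
    using w by (simp add: norm_g mult_left_mono flip: ennreal_mult)
qed

section \<open>Piecewise locally stationary processes\<close>

lemma Lp_norm_moment_le:
  assumes "Lp_norm M (real p) Y \<le> ennreal A" "0 < A" "0 < p" and Y: "Y \<in> borel_measurable M"
  shows "moment_le M p Y A"
proof -
  let ?I = "\<integral>\<^sup>+\<omega>. ennreal (norm (Y \<omega>) ^ p) \<partial>M"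
  have powr: "norm (Y \<omega>) powr real p = norm (Y \<omega>) ^ p" for \<omega>
    using \<open>0 < p\<close> by (cases "Y \<omega> = 0") (auto simp: powr_realpow)
  have "?I \<noteq> \<infinity>"
    using assms(1) by (auto simp: Lp_norm_def powr top_unique)
  then have fin: "?I = ennreal (enn2real ?I)" by (simp add: less_top)
  have "ennreal (enn2real ?I powr (1 / p)) \<le> ennreal A"
    using assms(1) \<open>?I \<noteq> \<infinity>\<close> by (simp add: Lp_norm_def powr)
  then have "enn2real ?I powr (1 / p) \<le> A" using \<open>0 < A\<close> by (simp add: ennreal_le_iff)
  then have "(enn2real ?I powr (1 / p)) ^ p \<le> A ^ p" by (intro power_mono) auto
  also have "(enn2real ?I powr (1 / p)) ^ p = enn2real ?I"
    using \<open>0 < p\<close> by (cases "enn2real ?I = 0") (auto simp: powr_powr simp flip: powr_realpow)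
  finally show ?thesis
    using \<open>0 < A\<close> Y by (subst (asm) ennreal_le_iff[symmetric]) (auto simp: moment_le_def simp flip: fin)
qed

lemma Lp_norm_2_square_le:
  assumes "(\<integral>\<^sup>+\<omega>. ennreal ((norm (Y \<omega>))\<^sup>2) \<partial>M) \<le> ennreal A"
  shows "(Lp_norm M 2 Y)\<^sup>2 \<le> ennreal A"
proof -
  let ?I = "\<integral>\<^sup>+\<omega>. ennreal ((norm (Y \<omega>))\<^sup>2) \<partial>M"
  have fin: "?I \<noteq> \<infinity>" using assms by (auto simp: top_unique)
  have "(Lp_norm M 2 Y)\<^sup>2 = ennreal ((enn2real ?I powr (1 / 2))\<^sup>2)"
    using fin by (simp add: Lp_norm_def ennreal_power)
  also have "(enn2real ?I powr (1 / 2))\<^sup>2 = enn2real ?I"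
    by (simp add: powr_half_sqrt)
  finally show ?thesis using assms fin by (simp add: less_top)
qed

text \<open>Exactly one summand of the process is active at each time, the break points being increasing.\<close>

lemma pls_process_regime:
  assumes model: "pls_model M eps eps' r d G" and k: "k \<in> {1..n}"
  obtains l where "l \<le> r" "real k / real n \<in> {d l<..d (Suc l)}"
    "pls_process eps r d G n k = (\<lambda>\<omega>. G l (real k / real n) (history eps (int k) \<omega>))"
    "G l (real k / real n) \<in> borel_measurable seq_space"
proof -
  define t where "t = real k / real n"
  have t: "0 < t" "t \<le> 1" using k by (auto simp: t_def)
  have d: "d 0 = 0" "d (Suc r) = 1" "\<And>j. j \<le> r \<Longrightarrow> d j < d (Suc j)"
    using model by (auto simp: pls_model_def)
  have d_mono: "d i \<le> d j" if "i \<le> j" "j \<le> Suc r" for i j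
    using that
  proof (induction j rule: dec_induct)
    case (step j)
    then have "d i \<le> d j" "d j < d (Suc j)" using d(3)[of j] by auto
    then show ?case by linarith
  qed simp
  have "\<exists>l<m. t \<in> {d l<..d (Suc l)}" if "t \<le> d m" for m
    using that
  proof (induction m)
    case 0
    then show ?case using t d by simp
  next
    case (Suc m)
    then show ?case by (cases "t \<le> d m") (auto intro: less_SucI)
  qed
  then obtain l where l: "l \<le> r" "t \<in> {d l<..d (Suc l)}"
    using t d(2) by (metis less_Suc_eq_le)
  have "pls_process eps r d G n k \<omega> = G l t (history eps (int k) \<omega>)" for \<omega>
  proof -
    have "indicator {d j<..d (Suc j)} t = (if j = l then 1 else 0 :: real)" if "j \<le> r" for j
    proof (cases j l rule: linorder_cases)
      case less
      then show ?thesis using d_mono[of "Suc j" l] l by auto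
    next
      case greater
      then show ?thesis using d_mono[of "Suc l" j] l that by auto
    qed (use l in auto)
    then have "pls_process eps r d G n k \<omega> = (\<Sum>j=0..r. if j = l then G l t (history eps (int k) \<omega>) else 0)"
      unfolding pls_process_def t_def[symmetric] by (intro sum.cong) auto
    then show ?thesis using l by simp
  qed
  moreover have "G l t \<in> borel_measurable seq_space"
  proof -
    have "(\<lambda>(t, x). G l t x) \<in> borel_measurable (restrict_space borel {d l<..d (Suc l)} \<Otimes>\<^sub>M seq_space)"
      using model l by (simp add: pls_model_def)
    from measurable_compose_Pair1[OF _ this, of t] l show ?thesis
      by (simp add: space_restrict_space)
  qed
  ultimately show ?thesis using that[of l] l by (auto simp: t_def fun_eq_iff)
qed

lemma Lp_norm_le_dep_measure:
  assumes "l \<le> r" "t \<in> {d l<..d (Suc l)}"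
  shows "Lp_norm M p (\<lambda>\<omega>. G l t (history eps 0 \<omega>) -
      G l t (history (eps(- int m := eps' (- int m))) 0 \<omega>)) \<le> dep_measure M eps eps' r d G m p"
proof -
  have "Lp_norm M p (\<lambda>\<omega>. G l t (history eps 0 \<omega>) - G l t (history (eps(- int m := eps' (- int m))) 0 \<omega>))
      \<le> (SUP t\<in>{d l<..d (Suc l)}. Lp_norm M p (\<lambda>\<omega>. G l t (history eps 0 \<omega>) -
          G l t (history (eps(- int m := eps' (- int m))) 0 \<omega>)))"
    using assms(2) by (rule SUP_upper)
  also have "\<dots> \<le> dep_measure M eps eps' r d G m p"
    unfolding dep_measure_def using assms(1) by (intro Max_ge) auto
  finally show ?thesis .
qed

lemma uniform_Lp_bound:
  assumes "(SUP n\<in>{1..}. MAX j\<in>{1..n}. Lp_norm M p (Y n j)) < \<infinity>"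
  obtains K where "0 < K" "\<And>n j. j \<in> {1..n::nat} \<Longrightarrow> Lp_norm M p (Y n j) \<le> ennreal K"
proof -
  define s where "s = (SUP n\<in>{1..}. MAX j\<in>{1..n}. Lp_norm M p (Y n j))"
  have "Lp_norm M p (Y n j) \<le> ennreal (enn2real s + 1)" if "j \<in> {1..n}" for n j
  proof -
    have "Lp_norm M p (Y n j) \<le> (MAX j\<in>{1..n}. Lp_norm M p (Y n j))"
      using that by (intro Max_ge) auto
    also have "\<dots> \<le> s"
      unfolding s_def using that by (intro SUP_upper) auto
    also have "\<dots> = ennreal (enn2real s)" using assms by (simp add: s_def)
    also have "\<dots> \<le> ennreal (enn2real s + 1)" by (intro ennreal_leI) auto
    finally show ?thesis .
  qed
  then show thesis using that[of "enn2real s + 1"] enn2real_nonneg[of s] by force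
qed

section \<open>The degenerate part\<close>

lemma (in prob_space) gamma_measurable [measurable]:
  assumes [measurable]: "L \<in> borel_measurable borel" "Y \<in> borel_measurable M"
  shows "(\<lambda>(\<omega>, x). gamma M L Y x \<omega>) \<in> borel_measurable (M \<Otimes>\<^sub>M borel)"
proof -
  have beta[measurable]: "(\<lambda>(\<omega>, x). beta L Y x \<omega>) \<in> borel_measurable (M \<Otimes>\<^sub>M borel)"
    unfolding beta_def by measurable
  have "(\<lambda>(x, \<omega>). beta L Y x \<omega>) \<in> borel_measurable (borel \<Otimes>\<^sub>M M)"
    using measurable_compose[OF measurable_pair_swap' beta] by (simp add: split_beta)
  then have [measurable]: "(\<lambda>x. \<integral>\<omega>. beta L Y x \<omega> \<partial>M) \<in> borel_measurable borel"
    by (rule borel_measurable_lebesgue_integral)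
  show ?thesis unfolding gamma_def by measurable
qed

lemma (in prob_space) integral_gamma:
  assumes "integrable M (gamma M L Y x)"
  shows "(\<integral>\<omega>. gamma M L Y x \<omega> \<partial>M) = 0"
proof -
  let ?c = "\<integral>\<omega>. beta L Y x \<omega> \<partial>M"
  have "integrable M (\<lambda>\<omega>. gamma M L Y x \<omega> + ?c)" using assms by simp
  then have "integrable M (beta L Y x)" by (simp add: gamma_def)
  then have "(\<integral>\<omega>. beta L Y x \<omega> - ?c \<partial>M) = 0" by (simp add: prob_space)
  then show ?thesis by (simp add: gamma_def)
qed

text \<open>As soon as there is a second grid point, the increment condition forces \<open>f\<close> to be nonnegative on
the grid. For \<open>n = 1\<close> it only compares a weight with itself.\<close>

lemma weight_delta_nonneg:
  fixes W f :: "nat \<Rightarrow> real \<Rightarrow> real \<Rightarrow> real"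
  assumes W_increment: "\<And>k j l m. k \<in> {1..n} \<Longrightarrow> j \<in> {1..n} \<Longrightarrow> l \<in> {1..n} \<Longrightarrow> m \<in> {1..n} \<Longrightarrow>
        \<bar>W n (real l / real n) (real m / real n) - W n (real k / real n) (real j / real n)\<bar>
          \<le> f n (real k / real n) (real j / real n) * norm (real l - real k, real m - real j) powr p"
    and n: "2 \<le> n"
  shows "0 \<le> weight_delta W f n"
  unfolding weight_delta_def
proof (intro sum_nonneg mult_nonneg_nonneg)
  fix k j assume k: "k \<in> {1..n}" and j: "j \<in> {1..n}"
  define l where "l = (if k = 1 then 2 else 1 :: nat)"
  have l: "l \<in> {1..n}" "l \<noteq> k" using n by (auto simp: l_def)
  have "0 \<le> f n (real k / real n) (real j / real n) * norm (real l - real k, real j - real j) powr p"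
    using W_increment[OF k j l(1) j] by linarith
  moreover have "0 < norm (real l - real k, real j - real j) powr p"
    using l by simp
  ultimately show "0 \<le> f n (real k / real n) (real j / real n)"
    by (simp add: zero_le_mult_iff)
qed auto

lemma (in innovations) variance_degenerate_part:
  fixes X :: "nat \<Rightarrow> nat \<Rightarrow> 'a \<Rightarrow> real" and L :: "real \<Rightarrow> real"
    and W :: "nat \<Rightarrow> real \<Rightarrow> real \<Rightarrow> real"
    and G :: "nat \<Rightarrow> (nat \<Rightarrow> real) \<Rightarrow> real"
  assumes L[measurable]: "L \<in> borel_measurable borel"
    and G[measurable]: "\<And>k. k \<in> {1..n} \<Longrightarrow> G k \<in> borel_measurable seq_space"
    and X: "\<And>k. k \<in> {1..n} \<Longrightarrow> X n k = (\<lambda>\<omega>. G k (history eps (int k) \<omega>))"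
    and coupling: "\<And>k x. k \<in> {1..n} \<Longrightarrow> geometric_coupling
       (\<lambda>z. complex_of_real (L (G k z)) * iexp (x * G k z) - (\<integral>\<omega>. beta L (X n k) x \<omega> \<partial>M))
       (int k) B (1 + \<bar>x\<bar> powr \<eta>) (q ^ 4)"
    and B: "1 \<le> B" and q: "0 < q" "q < 1" and \<eta>: "0 < \<eta>"
    and g: "integrable lborel g" "integrable lborel (\<lambda>z. norm z powr \<eta> * norm (g z))"
  defines "D \<equiv> degenerate_part M g L W X n"
  shows "(\<integral>\<^sup>+\<omega>. ennreal ((norm (D \<omega> - (\<integral>\<omega>'. D \<omega>' \<partial>M)))\<^sup>2) \<partial>M)
    \<le> ennreal ((\<integral>z. norm (g z) \<partial>lborel) * (64 * B ^ 6 / (1 - q)\<^sup>2 * weight_sum W n *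
        (\<integral>z. (1 + norm z powr \<eta>) * norm (g z) \<partial>lborel)))"
proof -
  define a where "a k j = W n (real k / real n) (real j / real n)" for k j
  define \<phi> where "\<phi> x k z = complex_of_real (L (G k z)) * iexp (x * G k z) - (\<integral>\<omega>. beta L (X n k) x \<omega> \<partial>M)" for x k z
  define S where "S z \<omega> = (\<Sum>k=1..n. \<Sum>j=1..n. complex_of_real (a k j) *
      gamma M L (X n k) (fst z) \<omega> * gamma M L (X n j) (snd z) \<omega>)" for z \<omega>
  have gamma: "gamma M L (X n k) x = (\<lambda>\<omega>. \<phi> x k (history eps (int k) \<omega>))" if "k \<in> {1..n}" for k x
    using X[OF that] by (simp add: gamma_def[abs_def] \<phi>_def beta_def[abs_def])
  have cpl: "geometric_coupling (\<phi> x k) (int k) B w (q ^ 4)" if "k \<in> {1..n}" "1 + \<bar>x\<bar> powr \<eta> \<le> w" for k x w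
    unfolding \<phi>_def[abs_def]
    by (rule geometric_coupling_mono[OF coupling[OF that(1)] that(2)]) (use B q in auto)
  have mean: "(\<integral>\<omega>. \<phi> x k (history eps (int k) \<omega>) \<partial>M) = 0" if k: "k \<in> {1..n}" for x k
  proof -
    have "moment_le M 4 (gamma M L (X n k) x) B"
      using cpl[OF k order_refl] by (simp add: geometric_coupling_def gamma[OF k])
    then have "moment_le M 1 (gamma M L (X n k) x) B"
      using moment_le_halve[of 1 "gamma M L (X n k) x" B] moment_le_halve[of 2 "gamma M L (X n k) x" B] by simp
    then have "(\<integral>\<omega>. gamma M L (X n k) x \<omega> \<partial>M) = 0"
      by (intro integral_gamma moment_le_1_integral)
    then show ?thesis by (simp add: gamma[OF k])
  qed
  have S_eq: "S z \<omega> = (\<Sum>k=1..n. \<Sum>j=1..n. complex_of_real (a k j) *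
      \<phi> (fst z) k (history eps (int k) \<omega>) * \<phi> (snd z) j (history eps (int j) \<omega>))" for z \<omega>
    unfolding S_def by (intro sum.cong refl) (simp add: gamma)
  let ?w = "\<lambda>z :: real \<times> real. 1 + norm z powr \<eta>"
  have le_w: "1 + \<bar>fst z\<bar> powr \<eta> \<le> ?w z" "1 + \<bar>snd z\<bar> powr \<eta> \<le> ?w z" for z :: "real \<times> real"
    using \<eta> norm_fst_le[of "fst z" "snd z"] norm_snd_le[of "snd z" "fst z"]
    by (auto intro!: powr_mono2)
  have w_pos: "0 < ?w z" for z using powr_ge_zero[of "norm z" \<eta>] by linarith
  note quad = variance_quadratic_form[where n = n and a = a and B = B and q = q and w = "?w z"
      and \<phi> = "\<phi> (fst z)" and \<psi> = "\<phi> (snd z)" for z, OF cpl[OF _ le_w(1)] cpl[OF _ le_w(2)] mean mean B w_pos q,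
      folded S_eq]
  have [measurable]: "X n k \<in> borel_measurable M" if "k \<in> {1..n}" for k
    using measurable_compose[OF history_measurable G[OF that]] X[OF that] by simp
  have gamma_joint: "(\<lambda>(\<omega>, z). gamma M L (X n k) (h z) \<omega>) \<in> borel_measurable (M \<Otimes>\<^sub>M lborel)"
    if "k \<in> {1..n}" and h: "h \<in> borel_measurable (lborel :: (real \<times> real) measure)" for k h
  proof -
    have "(\<lambda>(\<omega>, z). (\<omega>, h z)) \<in> M \<Otimes>\<^sub>M lborel \<rightarrow>\<^sub>M M \<Otimes>\<^sub>M borel"
      using h by measurable
    from measurable_compose[OF this gamma_measurable[OF L]] that show ?thesis
      by (simp add: split_beta)
  qed
  have proj: "fst \<in> borel_measurable (lborel :: (real \<times> real) measure)"
      "snd \<in> borel_measurable (lborel :: (real \<times> real) measure)"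
    by (auto simp: measurable_lborel1 intro!: borel_measurable_continuous_onI continuous_intros)
  have S_meas: "(\<lambda>(\<omega>, z). S z \<omega>) \<in> borel_measurable (M \<Otimes>\<^sub>M lborel)"
    unfolding S_def split_beta
    by (intro borel_measurable_sum borel_measurable_times borel_measurable_const
        gamma_joint[unfolded split_beta] proj)
  have g_w: "integrable lborel (\<lambda>z. ?w z * norm (g z))"
    using g by (simp add: distrib_right)
  have "D = (\<lambda>\<omega>. \<integral>z. g z * S z \<omega> \<partial>lborel)"
    by (simp add: D_def degenerate_part_def[abs_def] S_def a_def)
  moreover have "weight_sum W n = (\<Sum>k=1..n. \<Sum>j=1..n. (a k j)\<^sup>2)"
    by (simp add: weight_sum_def a_def)
  moreover have "0 \<le> 64 * B ^ 6 / (1 - q)\<^sup>2 * (\<Sum>k=1..n. \<Sum>j=1..n. (a k j)\<^sup>2)"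
    using B by (intro mult_nonneg_nonneg sum_nonneg divide_nonneg_nonneg) auto
  ultimately show ?thesis
    using variance_of_mixture[OF lborel.sigma_finite_measure_axioms g(1) S_meas quad(2) quad(1) g_w
        less_imp_le[OF w_pos]] by simp
qed

theorem theorem2:
  fixes M :: "'a measure"
    and eps eps' :: "int \<Rightarrow> 'a \<Rightarrow> real"
    and r :: nat
    and d :: "nat \<Rightarrow> real"
    and G :: "nat \<Rightarrow> real \<Rightarrow> (nat \<Rightarrow> real) \<Rightarrow> real"
    and X :: "nat \<Rightarrow> nat \<Rightarrow> 'a \<Rightarrow> real"
    and H :: "real \<Rightarrow> real \<Rightarrow> real"
    and W f :: "nat \<Rightarrow> real \<Rightarrow> real \<Rightarrow> real"
    and L L' :: "real \<Rightarrow> real"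
    and g :: "real \<times> real \<Rightarrow> complex"
    and \<eta> C \<rho> p :: real
    and D :: "nat \<Rightarrow> 'a \<Rightarrow> complex"
  defines "X \<equiv> pls_process eps r d G"
    and "D \<equiv> degenerate_part M g L W X"
  assumes model: "pls_model M eps eps' r d G"
    and H_borel: "(\<lambda>(x, y). H x y) \<in> borel_measurable borel"
    and H_sym: "\<And>x y. H x y = H y x"
    and W_borel: "\<And>n. (\<lambda>(s, t). W n s t) \<in> borel_measurable (restrict_space borel ({0..1} \<times> {0..1}))"
    and W_sym: "\<And>n s t. s \<in> {0..1} \<Longrightarrow> t \<in> {0..1} \<Longrightarrow> W n s t = W n t s"
    and eta: "0 < \<eta>" "\<eta> \<le> 1"
    and H_star: "(\<lambda>t s. H t s / (L t * L s)) \<in> wiener_ring \<eta>"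
    and g_repr: "wiener_repr \<eta> (\<lambda>t s. H t s / (L t * L s)) g"
    and L_deriv: "\<And>x. (L has_real_derivative L' x) (at x)"
    and L'_bound: "\<And>a b t. a \<le> t \<Longrightarrow> t \<le> b \<Longrightarrow> \<bar>L' t\<bar> \<le> C * (\<bar>L' a\<bar> + \<bar>L' b\<bar> + 1)"
    and L_moment: "(SUP n\<in>{1..}. MAX j\<in>{1..n}. Lp_norm M 8 (\<lambda>\<omega>. L (X n j \<omega>))) < \<infinity>"
    and L'_moment: "(SUP n\<in>{1..}. MAX j\<in>{1..n}. Lp_norm M 8 (\<lambda>\<omega>. L' (X n j \<omega>))) < \<infinity>"
    and rho: "0 \<le> \<rho>" "\<rho> < 1"
    and dep: "ennreal_bigo (\<lambda>k. dep_measure M eps eps' r d G k 8) (\<lambda>k. \<rho> ^ k)"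
    and p: "0 < p"
    and W_increment: "\<And>n k j l m. k \<in> {1..n} \<Longrightarrow> j \<in> {1..n} \<Longrightarrow> l \<in> {1..n} \<Longrightarrow> m \<in> {1..n} \<Longrightarrow>
        \<bar>W n (real l / real n) (real m / real n) - W n (real k / real n) (real j / real n)\<bar>
          \<le> f n (real k / real n) (real j / real n) *
             norm (real l - real k, real m - real j) powr p"
  shows "ennreal_bigo
           (\<lambda>n. (Lp_norm M 2 (\<lambda>\<omega>. D n \<omega> - (\<integral>\<omega>'. D n \<omega>' \<partial>M)))\<^sup>2)
           (\<lambda>n. weight_sum W n + weight_delta W f n)"
proof -
  interpret prob_space M using model by (simp add: pls_model_def)
  interpret innovations M eps eps' by unfold_locales (use model in \<open>simp add: pls_model_def\<close>)
  note L_meas[measurable] = derivative_measurable[OF L_deriv]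
  obtain K1 where K1: "0 < K1" "\<And>n j. j \<in> {1..n} \<Longrightarrow> Lp_norm M 8 (\<lambda>\<omega>. L (X n j \<omega>)) \<le> ennreal K1"
    using uniform_Lp_bound[OF L_moment] by blast
  obtain K2 where K2: "0 < K2" "\<And>n j. j \<in> {1..n} \<Longrightarrow> Lp_norm M 8 (\<lambda>\<omega>. L' (X n j \<omega>)) \<le> ennreal K2"
    using uniform_Lp_bound[OF L'_moment] by blast
  define K where "K = max K1 K2"
  have K: "0 < K" "ennreal K1 \<le> ennreal K" "ennreal K2 \<le> ennreal K"
    using K1 K2 by (auto simp: K_def intro!: ennreal_leI)
  obtain C' m0 where m0: "\<And>m. m0 \<le> m \<Longrightarrow> dep_measure M eps eps' r d G m 8 \<le> ennreal (C' * \<bar>\<rho> ^ m\<bar>)"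
    using dep unfolding ennreal_bigo_def eventually_sequentially by blast
  \<comment> \<open>The rate is made positive, so that geometric bounds are valid moment bounds.\<close>
  define \<rho>' where "\<rho>' = max \<rho> (1 / 2)"
  have rho': "0 < \<rho>'" "\<rho>' < 1" "\<rho> \<le> \<rho>'" using rho by (auto simp: \<rho>'_def)
  define b where "b = max C' 1"
  have b: "0 < b" "C' \<le> b" by (auto simp: b_def)
  have dep': "dep_measure M eps eps' r d G m 8 \<le> ennreal (b * \<rho>' ^ m)" if "m0 \<le> m" for m
  proof -
    have "C' * \<bar>\<rho> ^ m\<bar> \<le> b * \<rho>' ^ m"
      using b rho rho' by (intro mult_mono) (auto intro!: power_mono)
    then show ?thesis using m0[OF that] ennreal_leI order_trans by blast
  qed
  define q where "q = \<rho>' powr (\<eta> / 4)"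
  have q: "0 < q" "q < 1" "\<rho>' powr \<eta> = q ^ 4"
    using rho' eta powr_less_mono2[of "\<eta> / 4" \<rho>' 1]
    by (auto simp: q_def powr_powr simp flip: powr_realpow)
  define b' where "b' = b / (1 - \<rho>')"
  have b': "0 < b'" using b rho' by (simp add: b'_def)
  \<comment> \<open>The summands after \<open>1\<close> dominate, in this order, the size of the factors, their differences at lags
    below \<open>m0\<close>, and their differences at larger lags.\<close>
  define B where "B = 1 + 2 * K + 2 * K / (\<rho>' powr \<eta>) ^ m0 + ((\<bar>C\<bar> + 1) * (2 * K + 1) * b' + 4 * K * (1 + b'))"
  have B_parts: "0 \<le> 2 * K / (\<rho>' powr \<eta>) ^ m0" "0 \<le> (\<bar>C\<bar> + 1) * (2 * K + 1) * b' + 4 * K * (1 + b')"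
    using K b' by auto
  have B: "1 \<le> B" "2 * K \<le> B" "2 * K / (\<rho>' powr \<eta>) ^ m0 \<le> B" "(\<bar>C\<bar> + 1) * (2 * K + 1) * b' + 4 * K * (1 + b') \<le> B"
    unfolding B_def using B_parts K by linarith+
  have B': "2 * K \<le> B * (\<rho>' powr \<eta>) ^ m0"
    using B(3) rho' by (simp add: pos_divide_le_eq)

  have regime: "\<exists>Gk. Gk \<in> borel_measurable seq_space \<and> X n k = (\<lambda>\<omega>. Gk (history eps (int k) \<omega>)) \<and>
      (\<forall>x. geometric_coupling
       (\<lambda>z. complex_of_real (L (Gk z)) * iexp (x * Gk z) - (\<integral>\<omega>. beta L (X n k) x \<omega> \<partial>M))
       (int k) B (1 + \<bar>x\<bar> powr \<eta>) (q ^ 4))" if k: "k \<in> {1..n}" for n k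
  proof -
    obtain l where l: "l \<le> r" "real k / real n \<in> {d l<..d (Suc l)}"
      and X_eq: "X n k = (\<lambda>\<omega>. G l (real k / real n) (history eps (int k) \<omega>))"
      and meas[measurable]: "G l (real k / real n) \<in> borel_measurable seq_space"
      using pls_process_regime[OF model k] unfolding X_def by metis
    let ?G = "G l (real k / real n)"
    have L8: "moment_le M 8 (\<lambda>\<omega>. L (?G (history eps (int k) \<omega>))) K"
      using K1(2)[OF k] K by (intro Lp_norm_moment_le) (auto simp: X_eq intro: order_trans)
    have L'8: "moment_le M 8 (\<lambda>\<omega>. L' (?G (history eps (int k) \<omega>))) K"
      using K2(2)[OF k] K by (intro Lp_norm_moment_le) (auto simp: X_eq intro: order_trans)
    have one: "moment_le M 8 (\<lambda>\<omega>. ?G (history eps 0 \<omega>) -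
          ?G (history (eps(- int m := eps' (- int m))) 0 \<omega>)) (b * \<rho>' ^ m)" if "m0 \<le> m" for m
    proof (rule Lp_norm_moment_le)
      have [measurable]: "eps i \<in> borel_measurable M" "eps' i \<in> borel_measurable M" for i
        using E_measurable[of "Inl i"] E_measurable[of "Inr i"] by auto
      have [measurable]: "history (eps(- int m := eps' (- int m))) 0 \<in> M \<rightarrow>\<^sub>M seq_space"
        by (rule measurable_seq_space) (simp add: history_def)
      show "(\<lambda>\<omega>. ?G (history eps 0 \<omega>) - ?G (history (eps(- int m := eps' (- int m))) 0 \<omega>)) \<in> borel_measurable M"
        by measurable
      show "Lp_norm M (real 8) (\<lambda>\<omega>. ?G (history eps 0 \<omega>) -
          ?G (history (eps(- int m := eps' (- int m))) 0 \<omega>)) \<le> ennreal (b * \<rho>' ^ m)"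
        using order_trans[OF Lp_norm_le_dep_measure[OF l] dep'[OF that]] by simp
    qed (use b rho' in auto)
    have diff: "moment_le M 8 (\<lambda>\<omega>. ?G (history eps (int k) \<omega>) - ?G (refreshed_history s (int k) \<omega>))
        (b' * \<rho>' ^ nat (int k - s))" if "s \<le> int k" "m0 \<le> nat (int k - s)" for s
      using moment_le_refreshed_difference[OF meas _ rho'(1,2) that(1), of 8 b] one that(2)
      by (simp add: b'_def)
    have "geometric_coupling
       (\<lambda>z. complex_of_real (L (?G z)) * iexp (x * ?G z) - (\<integral>\<omega>. beta L (X n k) x \<omega> \<partial>M))
       (int k) B (1 + \<bar>x\<bar> powr \<eta>) (q ^ 4)" for x
      using oscillation_coupling[OF meas L_deriv L'_bound eta rho'(1,2) L8 L'8 diff B(2) B' B(4) b']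
      by (simp add: X_eq q(3))
    then show ?thesis using X_eq meas by blast
  qed

  define R where "R = (\<integral>z. norm (g z) \<partial>lborel) * (64 * B ^ 6 / (1 - q)\<^sup>2) *
      (\<integral>z. (1 + norm z powr \<eta>) * norm (g z) \<partial>lborel)"
  have R: "0 \<le> R" unfolding R_def
    using B by (intro mult_nonneg_nonneg divide_nonneg_nonneg integral_nonneg_AE) (auto intro!: AE_I2 add_nonneg_nonneg)
  have bound: "(Lp_norm M 2 (\<lambda>\<omega>. D n \<omega> - (\<integral>\<omega>'. D n \<omega>' \<partial>M)))\<^sup>2
      \<le> ennreal (R * \<bar>weight_sum W n + weight_delta W f n\<bar>)" if n: "2 \<le> n" for n
  proof -
    have "\<forall>k\<in>{1..n}. \<exists>Gk. Gk \<in> borel_measurable seq_space \<and> X n k = (\<lambda>\<omega>. Gk (history eps (int k) \<omega>)) \<and>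
      (\<forall>x. geometric_coupling
       (\<lambda>z. complex_of_real (L (Gk z)) * iexp (x * Gk z) - (\<integral>\<omega>. beta L (X n k) x \<omega> \<partial>M))
       (int k) B (1 + \<bar>x\<bar> powr \<eta>) (q ^ 4))"
      by (intro ballI regime)
    from bchoice[OF this] obtain Gf where
      Gf: "\<forall>k\<in>{1..n}. Gf k \<in> borel_measurable seq_space \<and> X n k = (\<lambda>\<omega>. Gf k (history eps (int k) \<omega>)) \<and>
      (\<forall>x. geometric_coupling
       (\<lambda>z. complex_of_real (L (Gf k z)) * iexp (x * Gf k z) - (\<integral>\<omega>. beta L (X n k) x \<omega> \<partial>M))
       (int k) B (1 + \<bar>x\<bar> powr \<eta>) (q ^ 4))" ..
    have "(\<integral>\<^sup>+\<omega>. ennreal ((norm (D n \<omega> - (\<integral>\<omega>'. D n \<omega>' \<partial>M)))\<^sup>2) \<partial>M)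
      \<le> ennreal ((\<integral>z. norm (g z) \<partial>lborel) * (64 * B ^ 6 / (1 - q)\<^sup>2 * weight_sum W n *
        (\<integral>z. (1 + norm z powr \<eta>) * norm (g z) \<partial>lborel)))"
      unfolding D_def
    proof (rule variance_degenerate_part[OF L_meas(1) _ _ _ B(1) q(1,2) eta(1)])
      show "Gf k \<in> borel_measurable seq_space" "X n k = (\<lambda>\<omega>. Gf k (history eps (int k) \<omega>))"
        "geometric_coupling
         (\<lambda>z. complex_of_real (L (Gf k z)) * iexp (x * Gf k z) - (\<integral>\<omega>. beta L (X n k) x \<omega> \<partial>M))
         (int k) B (1 + \<bar>x\<bar> powr \<eta>) (q ^ 4)" if "k \<in> {1..n}" for k x
        using bspec[OF Gf that] by blast+
      show "integrable lborel g" "integrable lborel (\<lambda>z. norm z powr \<eta> * norm (g z))"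
        using g_repr by (simp_all add: wiener_repr_def)
    qed
    also have "\<dots> = ennreal (R * weight_sum W n)" by (simp add: R_def mult_ac)
    also have "\<dots> \<le> ennreal (R * \<bar>weight_sum W n + weight_delta W f n\<bar>)"
      using weight_delta_nonneg[where W = W and f = f and n = n and p = p, OF W_increment n] R
      by (intro ennreal_leI mult_left_mono) auto
    finally show ?thesis by (rule Lp_norm_2_square_le)
  qed
  show ?thesis
    unfolding ennreal_bigo_def eventually_sequentially using bound by blast
qed

end
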